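(* Let $X$ be a real separable Banach space and $\gamma$ a centered Gaussian measure on $(X,\mathcal{B}(X))$ whose Cameron-Martin space $H(\gamma)$ is infinite-dimensional. Let $(\lambda_n)_{n\ge0}$, $(x_n)_{n\ge0}$, $(h_n)_{n\ge0}$ and $(h_n^* )_{n\ge0}$ be the sequences produced by the iterative decomposition of $\gamma$ described in the context. Then, for $\gamma$-almost every $x\in X$, $$x=\sum_{n\ge0}\langle x,h_n^*\rangle_{X,X^*}\,h_n$$ with convergence in $X$ (for the norm topology), where the random variables $h_n^*$ on $(X,\mathcal{B}(X),\gamma)$ are independent $\mathcal{N}(0,1)$. In equivalent form, if $(\xi_n)_{n\ge0}$ is a sequence of independent standard normal random variables on a probability space $(\Omega,\mathcal{F},\mathbb{P})$, then the random series $$\sum_{n\ge0}\sqrt{\lambda_n}\,\xi_n(\omega)\,x_n$$ defines (as an almost surely convergent series in $X$) an $X$-valued Gaussian random vector with distribution $\gamma$.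
   Context: $X^*$ is the topological dual of $X$, $\langle x,f\rangle_{X,X^*}=f(x)$ is the duality pairing, $B_{X^*}$ is the closed unit ball of $X^*$, and $\mathcal{B}(X)$ is the Borel $\sigma$-algebra. A probability measure $\gamma$ on $(X,\mathcal{B}(X))$ is a centered Gaussian measure if for every $f\in X^*$ the pushforward $\gamma\circ f^{-1}$ is a centered (possibly degenerate) Gaussian measure on $\mathbb{R}$. Its covariance operator is $R_\gamma:X^*\to X$, $R_\gamma f=\int_X\langle x,f\rangle_{X,X^*}\,x\,\gamma(dx)$ (Bochner integral). The Cameron-Martin space $H(\gamma)$ is the Hilbertian subspace of $X$ with kernel $R_\gamma$: the unique linear subspace of $X$ equipped with a Hilbert inner product $\langle\cdot,\cdot\rangle_\gamma$ which is continuously embedded in $X$, contains $R_\gamma(X^* )$ (as a dense subset), and satisfies $\langle h,f\rangle_{X,X^*}=\langle h,R_\gamma f\rangle_\gamma$ for all $h\in H(\gamma)$, $f\in X^*$. Iterative decomposition of $\gamma$: put $\gamma_0=\gamma$. Given the centered Gaussian measure $\gamma_n$ on $X$, let $\lambda_n=\max_{f\in B_{X^*}}\langle R_{\gamma_n}f,f\rangle_{X,X^*}$ (the maximum is attained), choose any $f_n\in B_{X^*}$ with $\lVert f_n\rVert_{X^*}=1$ and $\langle R_{\gamma_n}f_n,f_n\rangle_{X,X^*}=\lambda_n$, define $x_n\in X$ by $R_{\gamma_n}f_n=\lambda_nx_n$, put $h_n=\sqrt{\lambda_n}\,x_n$, and let $\gamma_{n+1}$ be the image (pushforward) of $\gamma_n$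 under $x\mapsto x-\langle x,f_n\rangle_{X,X^*}x_n$, i.e. the centered Gaussian measure with covariance operator $R_{\gamma_{n+1}}=R_{\gamma_n}-\lambda_n\langle x_n,\cdot\rangle_{X,X^*}x_n$. When $H(\gamma)$ is infinite-dimensional, $\lambda_n>0$ for all $n$ and the construction never stops. Define operators $P_n$ on $X$ recursively by $P_{-1}=0$ and $P_nx=\sum_{k=0}^n\langle x-P_{k-1}x,f_k\rangle_{X,X^*}x_k$, and set $x_0^*=f_0$, $x_n^*=(I-P_{n-1})^*f_n\in X^*$ for $n\ge1$, and $h_n^*=\lambda_n^{-1/2}x_n^*$ for $n\ge0$. *)

theory Defs
  imports "HOL-Probability.Probability"
begin

definition centered_gaussian_real :: "real measure \<Rightarrow> bool" where
  "centered_gaussian_real \<mu> \<longleftrightarrow>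
     \<mu> = return borel 0 \<or> (\<exists>\<sigma>>0. \<mu> = density lborel (normal_density 0 \<sigma>))"

definition centered_gaussian_measure ::
    "'a::{banach,second_countable_topology} measure \<Rightarrow> bool" where
  "centered_gaussian_measure \<gamma> \<longleftrightarrow>
     prob_space \<gamma> \<and> sets \<gamma> = sets borel \<and>
     (\<forall>f :: 'a \<Rightarrow>\<^sub>L real. centered_gaussian_real (distr \<gamma> borel (blinfun_apply f)))"

(* Total as a function of the measure: the Bochner integral is 0 for a non-integrable integrand.
   By Fernique's theorem this case does not arise for a Gaussian measure. *)
definition cov_op ::
    "'a::{banach,second_countable_topology} measure \<Rightarrow> ('a \<Rightarrow>\<^sub>L real) \<Rightarrow> 'a" where
  "cov_op \<gamma> f = (\<integral>v. blinfun_apply f v *\<^sub>R v \<partial>\<gamma>)"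

(* The values of the inner product ip outside H \<times> H are irrelevant. The last two conjuncts are
   completeness of H for the norm of ip and continuity of the embedding of H into the ambient space. *)
definition hilbertian_subspace :: "'a::banach set \<Rightarrow> ('a \<Rightarrow> 'a \<Rightarrow> real) \<Rightarrow> bool" where
  "hilbertian_subspace H ip \<longleftrightarrow>
     subspace H \<and>
     (\<forall>u\<in>H. \<forall>v\<in>H. ip u v = ip v u) \<and>
     (\<forall>u\<in>H. \<forall>v\<in>H. \<forall>w\<in>H. ip (u + v) w = ip u w + ip v w) \<and>
     (\<forall>c. \<forall>u\<in>H. \<forall>v\<in>H. ip (c *\<^sub>R u) v = c * ip u v) \<and>
     (\<forall>u\<in>H. u \<noteq> 0 \<longrightarrow> 0 < ip u u) \<and>
     (\<forall>s. (\<forall>n::nat. s n \<in> H) \<and>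
          (\<forall>e>0. \<exists>N. \<forall>m\<ge>N. \<forall>n\<ge>N. sqrt (ip (s m - s n) (s m - s n)) < e) \<longrightarrow>
          (\<exists>u\<in>H. (\<lambda>n. sqrt (ip (s n - u) (s n - u))) \<longlonglongrightarrow> 0)) \<and>
     (\<exists>C. \<forall>u\<in>H. norm u \<le> C * sqrt (ip u u))"

definition cameron_martin_space ::
    "'a::{banach,second_countable_topology} measure \<Rightarrow> 'a set \<Rightarrow> ('a \<Rightarrow> 'a \<Rightarrow> real) \<Rightarrow> bool" where
  "cameron_martin_space \<gamma> H ip \<longleftrightarrow>
     hilbertian_subspace H ip \<and>
     range (cov_op \<gamma>) \<subseteq> H \<and>
     (\<forall>u\<in>H. \<forall>e>0. \<exists>f. sqrt (ip (u - cov_op \<gamma> f) (u - cov_op \<gamma> f)) < e) \<and>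
     (\<forall>u\<in>H. \<forall>f. blinfun_apply f u = ip u (cov_op \<gamma> f))"

(* The sequences f range over all admissible choices of maximizers, so this is a relation.
   If lam n = 0 then x n would be unconstrained; this does not occur when the
   Cameron-Martin space is infinite-dimensional. *)
definition iterative_decomposition ::
    "'a::{banach,second_countable_topology} measure \<Rightarrow> (nat \<Rightarrow> 'a measure) \<Rightarrow> (nat \<Rightarrow> real) \<Rightarrow>
     (nat \<Rightarrow> 'a \<Rightarrow>\<^sub>L real) \<Rightarrow> (nat \<Rightarrow> 'a) \<Rightarrow> bool" where
  "iterative_decomposition \<gamma> G lam f x \<longleftrightarrow>
     G 0 = \<gamma> \<and>
     (\<forall>n. (\<forall>g. norm g \<le> 1 \<longrightarrow> blinfun_apply g (cov_op (G n) g) \<le> lam n) \<and>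
          norm (f n) = 1 \<and>
          blinfun_apply (f n) (cov_op (G n) (f n)) = lam n \<and>
          cov_op (G n) (f n) = lam n *\<^sub>R x n \<and>
          G (Suc n) = distr (G n) borel (\<lambda>v. v - blinfun_apply (f n) v *\<^sub>R x n))"

(* Indices are shifted by one: decomp_proj f x n is the operator P_{n-1}, so the value at 0
   is P_{-1} = 0. *)
fun decomp_proj ::
    "(nat \<Rightarrow> 'a::real_normed_vector \<Rightarrow>\<^sub>L real) \<Rightarrow> (nat \<Rightarrow> 'a) \<Rightarrow> nat \<Rightarrow> 'a \<Rightarrow>\<^sub>L 'a" where
  "decomp_proj f x 0 = 0"
| "decomp_proj f x (Suc n) =
     (\<Sum>k\<le>n. blinfun_scaleR_left (x k) o\<^sub>L f k o\<^sub>L (id_blinfun - decomp_proj f x k))"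

lemma decomp_proj_Suc_apply:
  "blinfun_apply (decomp_proj f x (Suc n)) v =
     (\<Sum>k\<le>n. blinfun_apply (f k) (v - blinfun_apply (decomp_proj f x k) v) *\<^sub>R x k)"
  by (simp add: blinfun.sum_left blinfun.diff_left)

definition decomp_x_dual ::
    "(nat \<Rightarrow> 'a::real_normed_vector \<Rightarrow>\<^sub>L real) \<Rightarrow> (nat \<Rightarrow> 'a) \<Rightarrow> nat \<Rightarrow> 'a \<Rightarrow>\<^sub>L real" where
  "decomp_x_dual f x n = f n o\<^sub>L (id_blinfun - decomp_proj f x n)"

definition decomp_h_dual ::
    "(nat \<Rightarrow> real) \<Rightarrow> (nat \<Rightarrow> 'a::real_normed_vector \<Rightarrow>\<^sub>L real) \<Rightarrow> (nat \<Rightarrow> 'a) \<Rightarrow> nat \<Rightarrow> 'a \<Rightarrow>\<^sub>L real" where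
  "decomp_h_dual lam f x n = inverse (sqrt (lam n)) *\<^sub>R decomp_x_dual f x n"

definition decomp_h :: "(nat \<Rightarrow> real) \<Rightarrow> (nat \<Rightarrow> 'a::real_normed_vector) \<Rightarrow> nat \<Rightarrow> 'a" where
  "decomp_h lam x n = sqrt (lam n) *\<^sub>R x n"

end

theory Submission
  imports Defs "HOL-Library.Diagonal_Subsequence"
begin

text \<open>
  Write \<open>x_n^*\<close> for the functional \<open>f n\<close> applied to what is left of a vector after the first \<open>n\<close>
  steps. The choice of \<open>x n\<close> as the regression coefficient of \<open>v\<close> on \<open>f n\<close> under \<open>G n\<close> makes each
  residual uncorrelated with all coordinates split off before, so that the normalised functionals
  \<open>h_n^*\<close> are orthonormal in \<open>L^2(\<gamma>)\<close> and \<open>h_n\<close> is the image of \<open>h_n^*\<close> under the covariance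
  operator. The statement is then an instance of a fact about every Gaussian measure: if functionals
  \<open>e k\<close> are orthonormal in \<open>L^2(\<gamma>)\<close> and satisfy Parseval's identity against every continuous
  functional, then \<open>v = (\<Sum>k. e k v *\<^sub>R cov_op \<gamma> (e k))\<close> almost surely (\<open>AE_sums\<close>), the
  coordinates are independent (\<open>indep_vars_e\<close>), and any independent standard normal coefficients
  give a series with law \<open>\<gamma>\<close> (\<open>random_series_law\<close>).

  Infinite dimension of the Cameron--Martin space excludes \<open>lam n = 0\<close> (\<open>lam_pos\<close>), so that the
  normalisation makes sense. Parseval's identity follows from \<open>lam n \<longlonglongrightarrow> 0\<close>, because \<open>lam n\<close>
  bounds the variance of the residual in every direction of the unit ball. Here compactness enters: two functionals \<open>f m\<close> and \<open>f n\<close> with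
  \<open>m < n\<close> have squared \<open>L^2\<close> distance at least \<open>lam n\<close> (\<open>lam_le_distance\<close>), whereas the dual unit
  ball is precompact in \<open>L^2(\<gamma>)\<close> (\<open>L2_precompact_functionals\<close>).

  The almost sure convergence rests on one symmetry. Reversing the sign of the coordinates \<open>m\<close> to
  \<open>n - 1\<close> is a bounded linear map which keeps the variance of every functional, hence it preserves
  \<open>\<gamma>\<close> (\<open>distr_reflection\<close>). The remainder after \<open>n\<close> terms is the midpoint of the remainders after \<open>m\<close> terms of \<open>v\<close> and of
  its reflection. With \<open>m = 0\<close> this makes the laws of all remainders uniformly tight, and since their
  one-dimensional variances tend to zero, the remainders tend to zero in probability
  (\<open>tail_tendsto_in_prob\<close>). For general \<open>m\<close> it yields Levy's maximal inequality
  (\<open>prob_tail_maximal\<close>), which upgrades this to almost sure convergence.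

  Two general results are developed for this purpose: a Borel probability measure on a separable
  normed space is determined by its characteristic functional (\<open>measure_eqI_char_functional\<close>), and
  the norm is square integrable under a Gaussian measure (\<open>integrable_norm_square\<close>), without which the
  covariance operator would not be given by a convergent integral.
\<close>

section \<open>Norming functionals\<close>

text \<open>
  The Hahn--Banach theorem for the norm, by Zorn's lemma applied to graphs: a partial functional
  dominated by the norm is a linear subspace \<open>G\<close> of \<open>'a \<times> real\<close> with \<open>r \<le> norm v\<close> for all
  \<open>(v, r) \<in> G\<close>. Such a subspace is automatically single-valued, since \<open>(0, r)\<close> and \<open>(0, - r)\<close> both
  lie in \<open>G\<close> only if \<open>r = 0\<close>; so no separate condition for a function is carried along.
\<close>
lemma norming_functional_exists:
  fixes x0 :: "'a::real_normed_vector"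
  shows "\<exists>f :: 'a \<Rightarrow>\<^sub>L real. norm f \<le> 1 \<and> blinfun_apply f x0 = norm x0"
proof -
  define \<A> where "\<A> = {G :: ('a \<times> real) set.
    subspace G \<and> (x0, norm x0) \<in> G \<and> (\<forall>(v, r)\<in>G. r \<le> norm v)}"
  have A1: "\<exists>M\<in>\<A>. \<forall>X\<in>\<A>. M \<subseteq> X \<longrightarrow> X = M"
  proof (rule subset_Zorn_nonempty)
    let ?G = "span {(x0, norm x0)}"
    have "?G \<in> \<A>"
      unfolding \<A>_def
    proof (intro CollectI conjI)
      show "subspace ?G" by (rule subspace_span)
      show "(x0, norm x0) \<in> ?G" by (rule span_base) simp
      have "t * norm x0 \<le> norm (t *\<^sub>R x0)" for t :: real
        by (simp add: mult_right_mono)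
      then show "\<forall>(v, r)\<in>?G. r \<le> norm v" by (auto simp: span_singleton)
    qed
    then show "\<A> \<noteq> {}" by auto
  next
    fix C assume C: "C \<noteq> {}" "subset.chain \<A> C"
    then have sub: "\<And>X. X \<in> C \<Longrightarrow> X \<in> \<A>" and
      ch: "\<And>X Y. X \<in> C \<Longrightarrow> Y \<in> C \<Longrightarrow> X \<subseteq> Y \<or> Y \<subseteq> X"
      by (auto simp: subset_chain_def)
    have "subspace (\<Union>C)"
      unfolding subspace_def
    proof (intro conjI ballI allI)
      show "0 \<in> \<Union>C" using C(1) sub by (auto simp: \<A>_def subspace_0)
    next
      fix p q assume "p \<in> \<Union>C" "q \<in> \<Union>C"
      then obtain X Y where XY: "X \<in> C" "Y \<in> C" "p \<in> X" "q \<in> Y" by auto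
      then obtain Z where "Z \<in> C" "p \<in> Z" "q \<in> Z" using ch[of X Y] by blast
      then show "p + q \<in> \<Union>C" using sub[of Z] by (auto simp: \<A>_def intro: subspace_add)
    next
      fix c :: real and p assume "p \<in> \<Union>C"
      then show "c *\<^sub>R p \<in> \<Union>C" using sub by (auto simp: \<A>_def intro: subspace_scale)
    qed
    moreover have "(x0, norm x0) \<in> \<Union>C" using C(1) sub by (auto simp: \<A>_def)
    moreover have "\<forall>(v, r)\<in>\<Union>C. r \<le> norm v" using sub by (fastforce simp: \<A>_def)
    ultimately show "\<Union>C \<in> \<A>" by (simp add: \<A>_def)
  qed
  then obtain G where G: "G \<in> \<A>" and max: "\<And>X. X \<in> \<A> \<Longrightarrow> G \<subseteq> X \<Longrightarrow> X = G" by blast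
  have sG: "subspace G" and x0G: "(x0, norm x0) \<in> G"
    and bG: "\<And>v r. (v, r) \<in> G \<Longrightarrow> r \<le> norm v"
    using G by (auto simp: \<A>_def)
  have total: "\<exists>r. (y, r) \<in> G" for y
  proof -
    \<comment> \<open>A value \<open>a\<close> at \<open>y\<close> keeps the extension dominated iff it lies above all \<open>r - norm (v - y)\<close> and
      below all \<open>norm (w + y) - s\<close>; the least upper bound of the former will do.\<close>
    define S where "S = {r - norm (v - y) | v r. (v, r) \<in> G}"
    have ne: "S \<noteq> {}" using x0G by (auto simp: S_def)
    have key: "r - norm (v - y) \<le> norm (w + y) - s" if "(v, r) \<in> G" "(w, s) \<in> G" for v r w s
    proof -
      have "(v + w, r + s) \<in> G" using subspace_add[OF sG that] by simp
      then have "r + s \<le> norm (v + w)" by (rule bG)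
      also have "\<dots> = norm ((v - y) + (w + y))" by (simp add: algebra_simps)
      also have "\<dots> \<le> norm (v - y) + norm (w + y)" by (rule norm_triangle_ineq)
      finally show ?thesis by simp
    qed
    have bdd: "bdd_above S"
      unfolding bdd_above_def S_def using key[OF _ x0G] by blast
    define a where "a = Sup S"
    have a1: "r - a \<le> norm (v - y)" if "(v, r) \<in> G" for v r
    proof -
      have "r - norm (v - y) \<in> S" using that by (auto simp: S_def)
      from cSup_upper[OF this bdd] show ?thesis by (simp add: a_def)
    qed
    have a2: "s + a \<le> norm (w + y)" if "(w, s) \<in> G" for w s
    proof -
      have "u \<le> norm (w + y) - s" if "u \<in> S" for u
        using that key[OF _ \<open>(w, s) \<in> G\<close>] by (auto simp: S_def)
      from cSup_least[OF ne this] show ?thesis by (simp add: a_def)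
    qed
    let ?G' = "{p + q | p q. p \<in> G \<and> q \<in> span {(y, a)}}"
    have bound: "r + t * a \<le> norm (v + t *\<^sub>R y)" if vr: "(v, r) \<in> G" for v r t
    proof -
      consider "t = 0" | "t > 0" | "t < 0" by linarith
      then show ?thesis
      proof cases
        case 1 then show ?thesis using bG[OF vr] by simp
      next
        case 2
        have "((1/t) *\<^sub>R v, r / t) \<in> G" using subspace_scale[OF sG vr, of "1/t"] by simp
        from a2[OF this] have "t * (r / t + a) \<le> t * norm ((1/t) *\<^sub>R v + y)"
          using 2 by (intro mult_left_mono) auto
        also have "\<dots> = norm (t *\<^sub>R ((1/t) *\<^sub>R v + y))" using 2 by simp
        also have "t *\<^sub>R ((1/t) *\<^sub>R v + y) = v + t *\<^sub>R y" using 2 by (simp add: algebra_simps)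
        finally show ?thesis using 2 by (simp add: distrib_left)
      next
        case 3
        have "((1/(-t)) *\<^sub>R v, r / (-t)) \<in> G" using subspace_scale[OF sG vr, of "1/(-t)"] by simp
        from a1[OF this] have "(-t) * (r / (-t) - a) \<le> (-t) * norm ((1/(-t)) *\<^sub>R v - y)"
          using 3 by (intro mult_left_mono) auto
        also have "\<dots> = norm ((-t) *\<^sub>R ((1/(-t)) *\<^sub>R v - y))" using 3 by simp
        also have "(-t) *\<^sub>R ((1/(-t)) *\<^sub>R v - y) = v + t *\<^sub>R y" using 3 by (simp add: algebra_simps)
        finally show ?thesis using 3 by (simp add: right_diff_distrib)
      qed
    qed
    have sub': "G \<subseteq> ?G'"
    proof
      fix p assume "p \<in> G"
      then have "p + 0 \<in> ?G'" using span_zero by blast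
      then show "p \<in> ?G'" by simp
    qed
    have "?G' \<in> \<A>"
      unfolding \<A>_def
    proof (rule CollectI, intro conjI)
      show "subspace ?G'" using subspace_sums[OF sG subspace_span] by simp
      show "(x0, norm x0) \<in> ?G'" using sub' x0G by blast
      show "\<forall>(v, r)\<in>?G'. r \<le> norm v" using bound by (auto simp: span_singleton)
    qed
    then have "?G' = G" using max sub' by blast
    moreover have "(y, a) \<in> ?G'"
    proof -
      have "0 + (y, a) \<in> ?G'" using subspace_0[OF sG] span_base[of "(y, a)" "{(y, a)}"] by blast
      then show ?thesis by simp
    qed
    ultimately show ?thesis by blast
  qed
  have uniq: "r = s" if "(v, r) \<in> G" "(v, s) \<in> G" for v r s
    using bG[of 0 "r - s"] bG[of 0 "s - r"] subspace_diff[OF sG that] subspace_diff[OF sG that(2,1)]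
    by simp
  define g where "g v = (THE r. (v, r) \<in> G)" for v
  have gG: "(v, g v) \<in> G" for v
  proof -
    have "\<exists>!r. (v, r) \<in> G" using total uniq by blast
    from theI'[OF this] show ?thesis by (simp add: g_def)
  qed
  have geq: "g v = r" if "(v, r) \<in> G" for v r using uniq[OF gG that] .
  have nb: "\<bar>g v\<bar> \<le> norm v" for v
  proof -
    have "(- v, - g v) \<in> G" using subspace_neg[OF sG gG] by simp
    then show ?thesis using bG[OF gG[of v]] bG[of "- v" "- g v"] by auto
  qed
  have "bounded_linear g"
  proof (rule bounded_linear_intro[where K = 1])
    show "g (u + v) = g u + g v" for u v using subspace_add[OF sG gG gG] by (auto intro: geq)
    show "g (c *\<^sub>R v) = c *\<^sub>R g v" for c v using subspace_scale[OF sG gG] by (auto intro: geq)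
    show "norm (g v) \<le> norm v * 1" for v using nb by simp
  qed
  then have "blinfun_apply (Blinfun g) = g" by (rule bounded_linear_Blinfun_apply)
  moreover have "norm (Blinfun g) \<le> 1"
    using calculation nb by (intro norm_blinfun_bound) auto
  ultimately show ?thesis using geq[OF x0G] by metis
qed

text \<open>
  It suffices to take a norming functional at each point of a countable dense set, because both
  \<open>norm\<close> and functionals in the dual unit ball are 1-Lipschitz.
\<close>
lemma norming_sequence_exists:
  obtains g :: "nat \<Rightarrow> 'a::{real_normed_vector,second_countable_topology} \<Rightarrow>\<^sub>L real"
  where "\<And>k. norm (g k) \<le> 1"
    and "\<And>v r. norm v \<le> r \<longleftrightarrow> (\<forall>k. blinfun_apply (g k) v \<le> r)"
proof -
  obtain D :: "'a set" where D: "countable D" "\<And>U. open U \<Longrightarrow> U \<noteq> {} \<Longrightarrow> \<exists>d\<in>D. d \<in> U"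
    using countable_dense_exists by blast
  have Dne: "D \<noteq> {}" using D(2)[OF open_UNIV] by auto
  define d where "d = from_nat_into D"
  have "\<exists>f :: 'a \<Rightarrow>\<^sub>L real. norm f \<le> 1 \<and> blinfun_apply f (d k) = norm (d k)" for k
    by (rule norming_functional_exists)
  then obtain g :: "nat \<Rightarrow> 'a \<Rightarrow>\<^sub>L real"
    where g: "\<And>k. norm (g k) \<le> 1" "\<And>k. blinfun_apply (g k) (d k) = norm (d k)" by metis
  have le: "\<bar>blinfun_apply (g k) v\<bar> \<le> norm v" for k v
    using norm_blinfun[of "g k" v] mult_right_mono[OF g(1)[of k] norm_ge_zero[of v]] by simp
  have "norm v \<le> r" if *: "\<forall>k. blinfun_apply (g k) v \<le> r" for v r
  proof (rule field_le_epsilon)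
    fix e :: real assume e: "0 < e"
    obtain k where k: "norm (v - d k) < e / 2"
      using D(2)[of "ball v (e / 2)"] e from_nat_into_surj[OF D(1)]
      by (force simp: d_def dist_norm)
    have "norm v \<le> norm (d k) + norm (v - d k)" by (metis norm_triangle_sub)
    also have "norm (d k) = blinfun_apply (g k) v - blinfun_apply (g k) (v - d k)"
      by (simp add: g(2)[symmetric] blinfun.diff_right)
    also have "\<dots> \<le> r + norm (v - d k)" using * le[of k "v - d k"] by (smt (verit))
    finally show "norm v \<le> r + e" using k by simp
  qed
  moreover have "blinfun_apply (g k) v \<le> r" if "norm v \<le> r" for v r k
    using le[of k v] that by simp
  ultimately show thesis using that g(1) by blast
qed

section \<open>The characteristic functional determines a Borel measure\<close>

lemma measurable_blinfun_apply [measurable (raw)]: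
  fixes A :: "'a::real_normed_vector \<Rightarrow>\<^sub>L 'b::real_normed_vector"
  assumes "h \<in> borel_measurable M"
  shows "(\<lambda>w. blinfun_apply A (h w)) \<in> borel_measurable M"
  by (rule measurable_compose[OF assms borel_measurable_continuous_onI])
     (intro continuous_intros)

text \<open>
  By the norming sequence, closed balls are countable intersections of half-spaces, and by
  separability every open set is a countable union of closed balls.
\<close>
lemma borel_eq_sigma_functionals:
  fixes E :: "'a::{real_normed_vector,second_countable_topology} set set"
  assumes "\<And>f :: 'a \<Rightarrow>\<^sub>L real. \<And>r. {v. blinfun_apply f v \<le> r} \<in> E"
    and "E \<subseteq> sets borel"
  shows "sets borel = sigma_sets UNIV E"
proof
  interpret S: sigma_algebra UNIV "sigma_sets UNIV E"
    by (rule sigma_algebra_sigma_sets) auto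
  obtain g :: "nat \<Rightarrow> 'a \<Rightarrow>\<^sub>L real"
    where g: "\<And>v r. norm v \<le> r \<longleftrightarrow> (\<forall>k. blinfun_apply (g k) v \<le> r)"
    using norming_sequence_exists by metis
  have ball: "cball y r \<in> sigma_sets UNIV E" for y r
  proof -
    have "cball y r = (\<Inter>k. {v. blinfun_apply (g k) v \<le> r + blinfun_apply (g k) y})"
      by (auto simp: dist_norm norm_minus_commute[of y] g blinfun.diff_right diff_le_eq)
    also have "\<dots> \<in> sigma_sets UNIV E"
      using assms(1) by (intro S.countable_INT) (auto intro: sigma_sets.Basic)
    finally show ?thesis .
  qed
  obtain D :: "'a set" where D: "countable D" "\<And>U. open U \<Longrightarrow> U \<noteq> {} \<Longrightarrow> \<exists>d\<in>D. d \<in> U"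
    using countable_dense_exists by blast
  have "U \<in> sigma_sets UNIV E" if "open U" for U
  proof -
    define I where "I = {p \<in> D \<times> (UNIV :: nat set). cball (fst p) (1 / Suc (snd p)) \<subseteq> U}"
    have "U = (\<Union>p\<in>I. cball (fst p) (1 / Suc (snd p)))" (is "_ = ?R")
    proof
      show "U \<subseteq> ?R"
      proof
        fix u assume "u \<in> U"
        obtain e where e: "e > 0" "ball u e \<subseteq> U"
          by (rule openE[OF \<open>open U\<close> \<open>u \<in> U\<close>])
        obtain n :: nat where n: "1 / Suc n < e / 2"
          using nat_approx_posE[of "e / 2"] e by auto
        obtain d where d: "d \<in> D" "d \<in> ball u (1 / Suc n)"
          using D(2)[of "ball u (1 / Suc n)"] by auto
        have "cball d (1 / Suc n) \<subseteq> ball u e"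
        proof
          fix w assume w: "w \<in> cball d (1 / Suc n)"
          have "dist u w \<le> dist u d + dist d w" by (rule dist_triangle)
          then show "w \<in> ball u e" using d w n by auto
        qed
        then have "(d, n) \<in> I" using d e by (auto simp: I_def)
        moreover have "u \<in> cball d (1 / Suc n)" using d by (simp add: dist_commute)
        ultimately show "u \<in> ?R" by (intro UN_I[of "(d, n)"]) simp_all
      qed
      show "?R \<subseteq> U" unfolding I_def by blast
    qed
    also have "\<dots> \<in> sigma_sets UNIV E"
    proof (rule S.countable_UN'')
      have "countable (D \<times> (UNIV :: nat set))" using D(1) by simp
      then show "countable I" by (rule countable_subset[rotated]) (auto simp: I_def)
    qed (rule ball)
    finally show ?thesis .
  qed
  then have "{U. open U} \<subseteq> sigma_sets UNIV E" by blast
  then have "sigma_sets UNIV {U. open U} \<subseteq> sigma_sets UNIV E" by (rule S.sigma_sets_subset)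
  then show "sets borel \<subseteq> sigma_sets UNIV E" by (simp add: borel_def)
  show "sigma_sets UNIV E \<subseteq> sets borel"
    using assms(2) sets.sigma_sets_subset[of E borel] by simp
qed

text \<open>
  Levy's uniqueness theorem for the image under \<open>g\<close> of the finite measure with density \<open>w\<close>, after
  division by its total mass \<open>c\<close>. The weight is what allows coordinates to be fixed one at a time.
\<close>
lemma weighted_Levy_uniqueness:
  fixes w g :: "'a \<Rightarrow> real"
  assumes "prob_space \<mu>" "prob_space \<nu>"
    and [measurable]: "w \<in> borel_measurable \<mu>" "w \<in> borel_measurable \<nu>"
    and [measurable]: "g \<in> borel_measurable \<mu>" "g \<in> borel_measurable \<nu>"
    and w: "\<And>v. 0 \<le> w v" "\<And>v. w v \<le> B"
    and eq: "\<And>t. (\<integral>v. w v *\<^sub>R iexp (t * g v) \<partial>\<mu>) = (\<integral>v. w v *\<^sub>R iexp (t * g v) \<partial>\<nu>)"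
    and [measurable]: "A \<in> sets borel"
  shows "(\<integral>v. w v * indicator A (g v) \<partial>\<mu>) = (\<integral>v. w v * indicator A (g v) \<partial>\<nu>)"
proof -
  interpret \<mu>: prob_space \<mu> by fact
  interpret \<nu>: prob_space \<nu> by fact
  have int: "integrable \<mu> w" "integrable \<nu> w"
    using w by (auto intro!: \<mu>.integrable_const_bound[where B = B] \<nu>.integrable_const_bound[where B = B])
  define c where "c = (\<integral>v. w v \<partial>\<mu>)"
  have "complex_of_real (\<integral>v. w v \<partial>\<mu>) = complex_of_real (\<integral>v. w v \<partial>\<nu>)"
    using eq[of 0] by (simp add: scaleR_conv_of_real)
  then have c\<nu>: "c = (\<integral>v. w v \<partial>\<nu>)" unfolding c_def using of_real_eq_iff by blast
  have c0: "c \<ge> 0" unfolding c_def using w by (intro integral_nonneg_AE) auto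
  show ?thesis
  proof (cases "c = 0")
    case True
    have "AE v in \<mu>. w v = 0" "AE v in \<nu>. w v = 0"
      using integral_nonneg_eq_0_iff_AE[OF int(1)] integral_nonneg_eq_0_iff_AE[OF int(2)] True w
      unfolding c_def[symmetric] c\<nu>[symmetric] by auto
    then have "(\<integral>v. w v * indicator A (g v) \<partial>\<mu>) = 0" "(\<integral>v. w v * indicator A (g v) \<partial>\<nu>) = 0"
      by (auto intro!: integral_eq_zero_AE)
    then show ?thesis by simp
  next
    case False
    with c0 have c: "c > 0" by simp
    define D where "D m = distr (density m (\<lambda>v. ennreal (w v / c))) borel g" for m
    have D: "real_distribution (D m) \<and> (\<forall>t. char (D m) t = (\<integral>v. w v *\<^sub>R iexp (t * g v) \<partial>m) / c)
        \<and> measure (D m) A = (\<integral>v. w v * indicator A (g v) \<partial>m) / c"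
      if "prob_space m" and [measurable]: "w \<in> borel_measurable m" "g \<in> borel_measurable m"
        and i: "integrable m w" and cm: "c = (\<integral>v. w v \<partial>m)" for m
    proof -
      interpret m: prob_space m by fact
      have "emeasure (density m (\<lambda>v. ennreal (w v / c))) (space m) = (\<integral>\<^sup>+v. ennreal (w v / c) \<partial>m)"
        by (simp add: emeasure_density cong: nn_integral_cong)
      also have "\<dots> = ennreal (\<integral>v. w v / c \<partial>m)"
        using i w c by (intro nn_integral_eq_integral) auto
      also have "\<dots> = 1" using c cm by simp
      finally have ps: "prob_space (density m (\<lambda>v. ennreal (w v / c)))"
        by (intro prob_spaceI) simp
      then interpret d: prob_space "density m (\<lambda>v. ennreal (w v / c))" .
      have rd: "real_distribution (D m)"
        unfolding D_def by (rule d.real_distribution_distr) simp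
      have ch: "char (D m) t = (\<integral>v. w v *\<^sub>R iexp (t * g v) \<partial>m) / c" for t
      proof -
        have "char (D m) t = (\<integral>v. (w v / c) *\<^sub>R iexp (t * g v) \<partial>m)"
          unfolding char_def D_def
          using w c by (subst integral_distr) (auto simp: integral_density)
        also have "\<dots> = (\<integral>v. (w v *\<^sub>R iexp (t * g v)) / c \<partial>m)"
          by (intro Bochner_Integration.integral_cong) (auto simp: scaleR_conv_of_real)
        finally show ?thesis by simp
      qed
      have "measure (D m) A = (\<integral>x. indicator A x \<partial>D m)"
        by (simp add: D_def)
      also have "\<dots> = (\<integral>v. (w v / c) *\<^sub>R indicator A (g v) \<partial>m)"
        unfolding D_def
        using w c by (subst integral_distr) (auto simp: integral_density)
      also have "\<dots> = (\<integral>v. w v * indicator A (g v) / c \<partial>m)"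
        by (intro Bochner_Integration.integral_cong) auto
      finally show ?thesis using rd ch by simp
    qed
    have 1: "real_distribution (D \<mu>) \<and> (\<forall>t. char (D \<mu>) t = (\<integral>v. w v *\<^sub>R iexp (t * g v) \<partial>\<mu>) / c)
        \<and> measure (D \<mu>) A = (\<integral>v. w v * indicator A (g v) \<partial>\<mu>) / c"
      by (rule D) (use assms int c_def in auto)
    have 2: "real_distribution (D \<nu>) \<and> (\<forall>t. char (D \<nu>) t = (\<integral>v. w v *\<^sub>R iexp (t * g v) \<partial>\<nu>) / c)
        \<and> measure (D \<nu>) A = (\<integral>v. w v * indicator A (g v) \<partial>\<nu>) / c"
      by (rule D) (use assms int c\<nu> in auto)
    have "D \<mu> = D \<nu>"
      using 1 2 eq by (intro Levy_uniqueness) (auto simp: fun_eq_iff)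
    then show ?thesis using 1 2 c by simp
  qed
qed

lemma iexp_add: "iexp (a + b) = iexp a * iexp b"
  by (simp add: ring_distribs exp_add)

text \<open>
  A weight must be nonnegative, which rules out \<open>iexp b\<close> itself. The function \<open>1 + cos (b - \<theta>)\<close> is
  nonnegative, keeps products of exponentials within the span of exponentials, and for \<open>\<theta> = 0\<close> and
  \<open>\<theta> = pi / 2\<close> recovers the real and imaginary parts of \<open>iexp b\<close>.
\<close>
lemma cos_weight_iexp:
  "(1 + cos (b - \<theta>)) *\<^sub>R iexp a
     = iexp a + iexp (- \<theta>) / 2 * iexp (a + b) + iexp \<theta> / 2 * iexp (a - b)"
proof -
  have "complex_of_real (cos (b - \<theta>)) = (iexp (b - \<theta>) + iexp (\<theta> - b)) / 2"
    by (simp add: cos_of_real[symmetric] cos_exp_eq algebra_simps del: cos_of_real)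
  moreover have "iexp (a + b) = iexp a * iexp b" "iexp (a - b) = iexp a * iexp (- b)"
     "iexp (b - \<theta>) = iexp b * iexp (- \<theta>)" "iexp (\<theta> - b) = iexp \<theta> * iexp (- b)"
    using iexp_add[of a b] iexp_add[of a "- b"] iexp_add[of b "- \<theta>"] iexp_add[of \<theta> "- b"]
    by simp_all
  moreover have "(1 + cos (b - \<theta>)) *\<^sub>R iexp a = (1 + complex_of_real (cos (b - \<theta>))) * iexp a"
    by (simp only: scaleR_conv_of_real of_real_add of_real_1)
  moreover have "(1 + (B * T' + T * B') / 2) * A = A + T' / 2 * (A * B) + T / 2 * (A * B')"
    for A B B' T T' :: complex
    by (simp add: distrib_left distrib_right add_divide_distrib mult_ac)
  ultimately show ?thesis by (simp only:)
qed

text \<open>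
  The indicator function of a cylinder set, written as a product so that one coordinate can be split
  off at a time.
\<close>
definition cylinder_weight :: "(('a::real_normed_vector \<Rightarrow>\<^sub>L real) \<times> real set) list \<Rightarrow> 'a \<Rightarrow> real" where
  "cylinder_weight L v = (\<Prod>(f, A)\<leftarrow>L. indicator A (blinfun_apply f v))"

lemma cylinder_weight_simps:
  "cylinder_weight [] v = 1"
  "cylinder_weight ((f, A) # L) v = indicator A (blinfun_apply f v) * cylinder_weight L v"
  by (simp_all add: cylinder_weight_def)

lemma cylinder_weight_bounds: "0 \<le> cylinder_weight L v" "cylinder_weight L v \<le> 1"
  by (induction L) (auto simp: cylinder_weight_simps indicator_def)

lemma cylinder_weight_measurable:
  assumes "sets M = sets borel" "\<forall>(f, A)\<in>set L. A \<in> sets borel"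
  shows "cylinder_weight L \<in> borel_measurable M"
  using assms(2)
proof (induction L)
  case Nil
  have "cylinder_weight [] = (\<lambda>v::'a. 1)" by (auto simp: cylinder_weight_simps)
  then show ?case by simp
next
  case (Cons p L)
  obtain f A where p: "p = (f, A)" by (cases p)
  note [measurable_cong] = assms(1)
  have [measurable]: "A \<in> sets borel" "cylinder_weight L \<in> borel_measurable M"
    using Cons p by auto
  have "cylinder_weight (p # L) = (\<lambda>v. indicator A (blinfun_apply f v) * cylinder_weight L v)"
    by (auto simp: p cylinder_weight_simps)
  then show ?case by simp
qed

text \<open>
  A multivariate uniqueness theorem obtained from the one-dimensional one by induction on the number of
  coordinates. The factor \<open>iexp (g v)\<close> with arbitrary \<open>g\<close> is the reason the induction works: the
  hypothesis for \<open>t *\<^sub>R f\<close>, \<open>t *\<^sub>R f + h\<close> and \<open>t *\<^sub>R f - h\<close> determines the characteristic function of \<open>f\<close>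
  under the weight \<open>cylinder_weight L v * (1 + cos (h v - \<theta>))\<close>, so that an indicator of \<open>f\<close> can be
  inserted, and the choice of \<open>\<theta>\<close> then restores the factor \<open>iexp (g v)\<close>.
\<close>
lemma cylinder_weight_integral_eq:
  fixes \<mu> \<nu> :: "'a::real_normed_vector measure"
  assumes "prob_space \<mu>" "prob_space \<nu>"
    and sets: "sets \<mu> = sets borel" "sets \<nu> = sets borel"
    and char: "\<And>f :: 'a \<Rightarrow>\<^sub>L real.
      (\<integral>v. iexp (blinfun_apply f v) \<partial>\<mu>) = (\<integral>v. iexp (blinfun_apply f v) \<partial>\<nu>)"
    and L: "\<forall>(f, A)\<in>set L. A \<in> sets borel"
  shows "(\<integral>v. cylinder_weight L v *\<^sub>R iexp (blinfun_apply g v) \<partial>\<mu>)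
       = (\<integral>v. cylinder_weight L v *\<^sub>R iexp (blinfun_apply g v) \<partial>\<nu>)"
  using L
proof (induction L arbitrary: g)
  case Nil
  then show ?case by (simp add: cylinder_weight_simps char)
next
  case (Cons p L)
  obtain f A where p: "p = (f, A)" by (cases p)
  have L: "\<forall>(f, A)\<in>set L. A \<in> sets borel" and A [measurable]: "A \<in> sets borel"
    using Cons.prems p by auto
  let ?W = "cylinder_weight L"
  have W\<mu> [measurable]: "?W \<in> borel_measurable \<mu>" and W\<nu> [measurable]: "?W \<in> borel_measurable \<nu>"
    using cylinder_weight_measurable[OF _ L] sets by auto
  note [measurable_cong] = sets
  note Wb = cylinder_weight_bounds[of L]
  have W1: "\<bar>?W v\<bar> \<le> 1" for v using Wb[of v] by simp
  have split: "(\<integral>v. (?W v * (1 + cos (blinfun_apply h v - \<theta>))) *\<^sub>R iexp (t * blinfun_apply f v) \<partial>m)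
      = (\<integral>v. ?W v *\<^sub>R iexp (blinfun_apply (t *\<^sub>R f) v) \<partial>m)
        + iexp (- \<theta>) / 2 * (\<integral>v. ?W v *\<^sub>R iexp (blinfun_apply (t *\<^sub>R f + h) v) \<partial>m)
        + iexp \<theta> / 2 * (\<integral>v. ?W v *\<^sub>R iexp (blinfun_apply (t *\<^sub>R f - h) v) \<partial>m)"
    if "prob_space m" and [measurable]: "?W \<in> borel_measurable m"
      and [measurable_cong]: "sets m = sets borel" for m \<theta> t h
  proof -
    interpret m: prob_space m by fact
    have I: "integrable m (\<lambda>v. ?W v *\<^sub>R iexp (blinfun_apply h' v))" for h'
      using W1 by (intro m.integrable_const_bound[where B = 1]) auto
    have eq: "(?W v * (1 + cos (blinfun_apply h v - \<theta>))) *\<^sub>R iexp (t * blinfun_apply f v)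
       = ?W v *\<^sub>R iexp (blinfun_apply (t *\<^sub>R f) v)
        + iexp (- \<theta>) / 2 * (?W v *\<^sub>R iexp (blinfun_apply (t *\<^sub>R f + h) v))
        + iexp \<theta> / 2 * (?W v *\<^sub>R iexp (blinfun_apply (t *\<^sub>R f - h) v))" for v
      unfolding scaleR_scaleR[symmetric] cos_weight_iexp
      by (simp add: blinfun.add_left blinfun.diff_left blinfun.scaleR_left scaleR_add_right)
    show ?thesis
      by (simp only: eq Bochner_Integration.integral_add Bochner_Integration.integrable_add
          integrable_mult_right I integral_mult_right_zero)
  qed
  have cosW: "(\<integral>v. ?W v * (1 + cos (blinfun_apply h v - \<theta>)) * indicator A (blinfun_apply f v) \<partial>\<mu>)
      = (\<integral>v. ?W v * (1 + cos (blinfun_apply h v - \<theta>)) * indicator A (blinfun_apply f v) \<partial>\<nu>)"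
    if "h \<in> {0, g}" for \<theta> h
  proof (rule weighted_Levy_uniqueness[where B = 2])
    show "0 \<le> ?W v * (1 + cos (blinfun_apply h v - \<theta>))" for v
    proof (rule mult_nonneg_nonneg)
      show "0 \<le> 1 + cos (blinfun_apply h v - \<theta>)"
        using cos_ge_minus_one[of "blinfun_apply h v - \<theta>"] by linarith
    qed (rule Wb)
    show "?W v * (1 + cos (blinfun_apply h v - \<theta>)) \<le> 2" for v
      using mult_mono[OF Wb(2)[of v], of "1 + cos (blinfun_apply h v - \<theta>)" 2]
        cos_le_one[of "blinfun_apply h v - \<theta>"] cos_ge_minus_one[of "blinfun_apply h v - \<theta>"] by simp
    show "(\<integral>v. (?W v * (1 + cos (blinfun_apply h v - \<theta>))) *\<^sub>R iexp (t * blinfun_apply f v) \<partial>\<mu>)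
       = (\<integral>v. (?W v * (1 + cos (blinfun_apply h v - \<theta>))) *\<^sub>R iexp (t * blinfun_apply f v) \<partial>\<nu>)" for t
      using split[OF assms(1) W\<mu> sets(1)] split[OF assms(2) W\<nu> sets(2)]
      by (simp add: Cons.IH[OF L])
  qed (use assms in measurable)
  \<comment> \<open>The constant \<open>1\<close> of the weight is removed by subtracting the case \<open>h = 0\<close>, where the weight is
    \<open>2\<close>; this is why \<open>cosW\<close> covers both \<open>g\<close> and \<open>0\<close>.\<close>
  have cosA: "(\<integral>v. ?W v * cos (blinfun_apply g v - \<theta>) * indicator A (blinfun_apply f v) \<partial>\<mu>)
      = (\<integral>v. ?W v * cos (blinfun_apply g v - \<theta>) * indicator A (blinfun_apply f v) \<partial>\<nu>)" for \<theta>
  proof -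
    have "(\<integral>v. ?W v * cos (blinfun_apply g v - \<theta>) * indicator A (blinfun_apply f v) \<partial>m)
       = (\<integral>v. ?W v * (1 + cos (blinfun_apply g v - \<theta>)) * indicator A (blinfun_apply f v) \<partial>m)
        - (\<integral>v. ?W v * (1 + cos (blinfun_apply 0 v - 0)) * indicator A (blinfun_apply f v) \<partial>m) / 2"
      if "prob_space m" and [measurable]: "?W \<in> borel_measurable m"
        and [measurable_cong]: "sets m = sets borel" for m
    proof -
      interpret m: prob_space m by fact
      have "integrable m (\<lambda>v. ?W v * cos (blinfun_apply g v - \<theta>) * indicator A (blinfun_apply f v))"
        using W1 by (intro m.integrable_const_bound[where B = 1])
          (auto simp: abs_mult indicator_def intro!: mult_le_one)
      moreover have "integrable m (\<lambda>v. ?W v * indicator A (blinfun_apply f v))"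
        using W1 by (intro m.integrable_const_bound[where B = 1])
          (auto simp: abs_mult indicator_def)
      ultimately show ?thesis by (simp add: algebra_simps)
    qed
    from this[OF assms(1) W\<mu> sets(1)] this[OF assms(2) W\<nu> sets(2)] show ?thesis
      using cosW[of g \<theta>] cosW[of 0 0] by simp
  qed
  have reassemble: "(\<integral>v. cylinder_weight (p # L) v *\<^sub>R iexp (blinfun_apply g v) \<partial>m)
      = complex_of_real (\<integral>v. ?W v * cos (blinfun_apply g v - 0) * indicator A (blinfun_apply f v) \<partial>m)
      + \<i> * complex_of_real (\<integral>v. ?W v * cos (blinfun_apply g v - pi / 2) * indicator A (blinfun_apply f v) \<partial>m)"
    if "prob_space m" and [measurable]: "?W \<in> borel_measurable m"
      and [measurable_cong]: "sets m = sets borel" for m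
  proof -
    interpret m: prob_space m by fact
    have I: "integrable m (\<lambda>v. complex_of_real (?W v * cos (blinfun_apply g v - \<theta>) * indicator A (blinfun_apply f v)))" for \<theta>
      using W1 by (intro m.integrable_const_bound[where B = 1])
        (auto simp: norm_mult indicator_def intro!: mult_le_one)
    have eq: "cylinder_weight (p # L) v *\<^sub>R iexp (blinfun_apply g v)
      = complex_of_real (?W v * cos (blinfun_apply g v - 0) * indicator A (blinfun_apply f v))
      + \<i> * complex_of_real (?W v * cos (blinfun_apply g v - pi / 2) * indicator A (blinfun_apply f v))" for v
      by (simp add: p cylinder_weight_simps complex_eq_iff cos_diff Re_exp Im_exp)
    show ?thesis
      unfolding eq using I[of 0] I[of "pi / 2"]
      by (subst Bochner_Integration.integral_add) (auto simp del: of_real_mult)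
  qed
  show ?case
    using reassemble[OF assms(1) W\<mu> sets(1)] reassemble[OF assms(2) W\<nu> sets(2)] cosA by metis
qed

theorem measure_eqI_char_functional:
  fixes \<mu> \<nu> :: "'a::{real_normed_vector,second_countable_topology} measure"
  assumes "prob_space \<mu>" "prob_space \<nu>" "sets \<mu> = sets borel" "sets \<nu> = sets borel"
    and char: "\<And>f :: 'a \<Rightarrow>\<^sub>L real.
      (\<integral>v. iexp (blinfun_apply f v) \<partial>\<mu>) = (\<integral>v. iexp (blinfun_apply f v) \<partial>\<nu>)"
  shows "\<mu> = \<nu>"
proof -
  interpret \<mu>: prob_space \<mu> by fact
  interpret \<nu>: prob_space \<nu> by fact
  define cyl where "cyl L = {v :: 'a. \<forall>(f, A)\<in>set L. blinfun_apply f v \<in> A}"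
    for L :: "(('a \<Rightarrow>\<^sub>L real) \<times> real set) list"
  define E where "E = {cyl L | L. \<forall>(f, A)\<in>set L. A \<in> sets borel}"
  have ind: "cylinder_weight L v = indicator (cyl L) v" for L v
  proof (induction L)
    case (Cons p L)
    obtain f A where "p = (f, A)" by (cases p)
    moreover from this have "cyl (p # L) = {v. blinfun_apply f v \<in> A} \<inter> cyl L"
      by (auto simp: cyl_def)
    ultimately show ?case using Cons by (simp add: cylinder_weight_simps indicator_def)
  qed (simp add: cyl_def cylinder_weight_simps)
  have cb: "cyl L \<in> sets borel" if L: "\<forall>(f, A)\<in>set L. A \<in> sets borel" for L
  proof -
    have "cylinder_weight L = indicator (cyl L)" by (rule ext) (rule ind)
    then have "(indicator (cyl L) :: 'a \<Rightarrow> real) \<in> borel_measurable borel"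
      using cylinder_weight_measurable[OF refl L] by simp
    then show ?thesis by (simp add: borel_measurable_indicator_iff)
  qed
  have "sets borel = sigma_sets UNIV E"
  proof (rule borel_eq_sigma_functionals)
    show "{v. blinfun_apply f v \<le> r} \<in> E" for f :: "'a \<Rightarrow>\<^sub>L real" and r
    proof -
      have "{v. blinfun_apply f v \<le> r} = cyl [(f, {..r})]" by (simp add: cyl_def)
      then show ?thesis unfolding E_def by fastforce
    qed
    show "E \<subseteq> sets borel" using cb by (auto simp: E_def)
  qed
  show ?thesis
  proof (rule measure_eqI_generator_eq[where E = E and \<Omega> = UNIV and A = "\<lambda>_. UNIV"])
    show "Int_stable E"
    proof (rule Int_stableI)
      fix a b assume "a \<in> E" "b \<in> E"
      then obtain L L' where "a = cyl L" "b = cyl L'" "\<forall>(f, A)\<in>set L. A \<in> sets borel"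
        "\<forall>(f, A)\<in>set L'. A \<in> sets borel" by (auto simp: E_def)
      moreover have "cyl L \<inter> cyl L' = cyl (L @ L')" by (auto simp: cyl_def)
      ultimately show "a \<inter> b \<in> E"
        unfolding E_def by (intro CollectI exI[of _ "L @ L'"]) auto
    qed
    show "emeasure \<mu> X = emeasure \<nu> X" if "X \<in> E" for X
    proof -
      obtain L where L: "X = cyl L" "\<forall>(f, A)\<in>set L. A \<in> sets borel" using \<open>X \<in> E\<close> by (auto simp: E_def)
      have X: "X \<in> sets \<mu>" "X \<in> sets \<nu>" using cb L assms by auto
      have "complex_of_real (measure \<mu> X) = complex_of_real (measure \<nu> X)"
        using cylinder_weight_integral_eq[OF assms L(2), of 0] X
        by (simp add: ind L(1)[symmetric] scaleR_conv_of_real)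
      then show ?thesis by (simp add: \<mu>.emeasure_eq_measure \<nu>.emeasure_eq_measure)
    qed
    show "range (\<lambda>_. UNIV) \<subseteq> E"
    proof -
      have "UNIV = cyl []" by (simp add: cyl_def)
      then show ?thesis unfolding E_def by fastforce
    qed
  qed (use assms \<open>sets borel = sigma_sets UNIV E\<close> in auto)
qed

section \<open>Centered Gaussian measures have a second moment\<close>

lemma centered_gaussian_real_moments:
  assumes "centered_gaussian_real \<mu>"
  shows "integrable \<mu> (\<lambda>z. z\<^sup>2)"
    and "char \<mu> t = complex_of_real (exp (- (t\<^sup>2 * (\<integral>z. z\<^sup>2 \<partial>\<mu>)) / 2))"
    and "(\<integral>z. z\<^sup>2 \<partial>\<mu>) = 1 \<Longrightarrow> \<mu> = density lborel (normal_density 0 1)"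
proof -
  have "integrable \<mu> (\<lambda>z. z\<^sup>2) \<and> char \<mu> t = complex_of_real (exp (- (t\<^sup>2 * (\<integral>z. z\<^sup>2 \<partial>\<mu>)) / 2))
    \<and> ((\<integral>z. z\<^sup>2 \<partial>\<mu>) = 1 \<longrightarrow> \<mu> = density lborel (normal_density 0 1))"
  proof (cases "\<mu> = return borel 0")
    case True
    have "integrable \<mu> (\<lambda>z. z\<^sup>2)"
      unfolding True by (subst integrable_iff_bounded) (simp add: nn_integral_return)
    then show ?thesis by (simp add: True char_def integral_return)
  next
    case False
    then obtain \<sigma> where \<sigma>: "\<sigma> > 0" "\<mu> = density lborel (normal_density 0 \<sigma>)"
      using assms by (auto simp: centered_gaussian_real_def)
    interpret std: real_distribution std_normal_distribution by (rule real_dist_normal_dist)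
    have "distributed std_normal_distribution lborel (\<lambda>z. z) (normal_density 0 1)"
      by (auto simp: distributed_def intro!: distr_id2)
    from std.normal_density_affine[OF this, of \<sigma> 0] \<sigma>
    have "distributed std_normal_distribution lborel (\<lambda>z. \<sigma> * z) (normal_density 0 \<sigma>)" by simp
    then have \<mu>: "\<mu> = distr std_normal_distribution borel (\<lambda>z. \<sigma> * z)"
      unfolding \<sigma> distributed_def by (metis distr_cong sets_lborel)
    have i: "(\<integral>z. z\<^sup>2 \<partial>\<mu>) = \<sigma>\<^sup>2"
      using std_normal_distribution_even_moments(1)[of 1]
      unfolding \<mu> by (subst integral_distr) (auto simp: power_mult_distrib)
    have "integrable \<mu> (\<lambda>z. z\<^sup>2)"
      unfolding \<mu> using integrable_std_normal_distribution_moment[of 2]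
      by (subst integrable_distr_eq) (auto simp: power_mult_distrib)
    moreover have "char \<mu> t = char std_normal_distribution (t * \<sigma>)"
      unfolding \<mu> char_def by (subst integral_distr) (auto simp: mult_ac)
    moreover have "\<sigma> = 1" if "\<sigma>\<^sup>2 = 1"
      using that \<sigma>(1) by (simp add: power2_eq_1_iff)
    ultimately show ?thesis
      unfolding i by (auto simp: \<sigma>(2)[symmetric] char_std_normal_distribution power_mult_distrib)
         (simp add: \<sigma>(2))
  qed
  then show "integrable \<mu> (\<lambda>z. z\<^sup>2)"
    and "char \<mu> t = complex_of_real (exp (- (t\<^sup>2 * (\<integral>z. z\<^sup>2 \<partial>\<mu>)) / 2))"
    and "(\<integral>z. z\<^sup>2 \<partial>\<mu>) = 1 \<Longrightarrow> \<mu> = density lborel (normal_density 0 1)"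
    by simp_all
qed

locale centered_gaussian = prob_space \<gamma>
  for \<gamma> :: "'a::{banach,second_countable_topology} measure" +
  assumes sets_eq_borel [measurable_cong]: "sets \<gamma> = sets borel"
    and gaussian: "\<And>f :: 'a \<Rightarrow>\<^sub>L real. centered_gaussian_real (distr \<gamma> borel (blinfun_apply f))"

lemma centered_gaussian_iff: "centered_gaussian \<gamma> \<longleftrightarrow> centered_gaussian_measure \<gamma>"
  by (auto simp: centered_gaussian_def centered_gaussian_axioms_def centered_gaussian_measure_def)

context centered_gaussian
begin

lemma space_eq_UNIV [simp]: "space \<gamma> = UNIV"
  using sets_eq_imp_space_eq[OF sets_eq_borel] by simp

lemma integrable_functional_square:
  fixes f :: "'a \<Rightarrow>\<^sub>L real"
  shows "integrable \<gamma> (\<lambda>v. (blinfun_apply f v)\<^sup>2)"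
  using centered_gaussian_real_moments(1)[OF gaussian[of f]]
  by (subst (asm) integrable_distr_eq) auto

lemma char_functional:
  fixes f :: "'a \<Rightarrow>\<^sub>L real"
  shows "(\<integral>v. iexp (blinfun_apply f v) \<partial>\<gamma>)
    = complex_of_real (exp (- (\<integral>v. (blinfun_apply f v)\<^sup>2 \<partial>\<gamma>) / 2))"
proof -
  have "(\<integral>v. iexp (blinfun_apply f v) \<partial>\<gamma>) = char (distr \<gamma> borel (blinfun_apply f)) 1"
    by (simp add: char_def integral_distr)
  also have "\<dots> = complex_of_real (exp (- (\<integral>v. (blinfun_apply f v)\<^sup>2 \<partial>\<gamma>) / 2))"
    by (simp add: centered_gaussian_real_moments(2)[OF gaussian] integral_distr)
  finally show ?thesis .
qed

lemma distr_functional_standard: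
  fixes f :: "'a \<Rightarrow>\<^sub>L real"
  assumes "(\<integral>v. (blinfun_apply f v)\<^sup>2 \<partial>\<gamma>) = 1"
  shows "distr \<gamma> borel (blinfun_apply f) = density lborel (normal_density 0 1)"
  using centered_gaussian_real_moments(3)[OF gaussian[of f]] assms by (simp add: integral_distr)

text \<open>
  The image of \<open>\<gamma>\<close> under \<open>A\<close> is again centered Gaussian, and the characteristic functional of a
  centered Gaussian measure depends on the variances only.
\<close>
lemma distr_eq_if_variance_eq:
  fixes A :: "'a \<Rightarrow>\<^sub>L 'a"
  assumes "\<And>f :: 'a \<Rightarrow>\<^sub>L real.
    (\<integral>v. (blinfun_apply f (blinfun_apply A v))\<^sup>2 \<partial>\<gamma>) = (\<integral>v. (blinfun_apply f v)\<^sup>2 \<partial>\<gamma>)"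
  shows "distr \<gamma> borel (blinfun_apply A) = \<gamma>"
proof (rule measure_eqI_char_functional)
  fix f :: "'a \<Rightarrow>\<^sub>L real"
  have "(\<integral>v. iexp (blinfun_apply f v) \<partial>distr \<gamma> borel (blinfun_apply A))
      = (\<integral>v. iexp (blinfun_apply (f o\<^sub>L A) v) \<partial>\<gamma>)"
    by (subst integral_distr) auto
  also have "\<dots> = (\<integral>v. iexp (blinfun_apply f v) \<partial>\<gamma>)"
    unfolding char_functional using assms by simp
  finally show "(\<integral>v. iexp (blinfun_apply f v) \<partial>distr \<gamma> borel (blinfun_apply A))
      = (\<integral>v. iexp (blinfun_apply f v) \<partial>\<gamma>)" .
qed (auto intro!: prob_space_distr prob_space_axioms sets_eq_borel)

lemma char_functional_pair:
  fixes F :: "('a \<times> 'a) \<Rightarrow>\<^sub>L real" and f1 f2 :: "'a \<Rightarrow>\<^sub>L real"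
  assumes F: "\<And>u v. blinfun_apply F (u, v) = blinfun_apply f1 u + blinfun_apply f2 v"
  shows "(\<integral>p. iexp (blinfun_apply F p) \<partial>(\<gamma> \<Otimes>\<^sub>M \<gamma>))
    = complex_of_real (exp (- ((\<integral>v. (blinfun_apply f1 v)\<^sup>2 \<partial>\<gamma>) + (\<integral>v. (blinfun_apply f2 v)\<^sup>2 \<partial>\<gamma>)) / 2))"
proof -
  interpret P: pair_prob_space \<gamma> \<gamma> ..
  have [measurable_cong]: "sets (\<gamma> \<Otimes>\<^sub>M \<gamma>) = sets (borel :: ('a \<times> 'a) measure)"
    unfolding borel_prod[symmetric] by (intro sets_pair_measure_cong sets_eq_borel)
  have "(\<integral>p. iexp (blinfun_apply F p) \<partial>(\<gamma> \<Otimes>\<^sub>M \<gamma>))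
      = (\<integral>u. \<integral>v. iexp (blinfun_apply F (u, v)) \<partial>\<gamma> \<partial>\<gamma>)"
    by (intro P.integral_fst'[symmetric] P.integrable_const_bound[where B = 1]) auto
  also have "\<dots> = (\<integral>u. \<integral>v. iexp (blinfun_apply f1 u) * iexp (blinfun_apply f2 v) \<partial>\<gamma> \<partial>\<gamma>)"
    unfolding F iexp_add ..
  also have "\<dots> = (\<integral>u. iexp (blinfun_apply f1 u) \<partial>\<gamma>) * (\<integral>v. iexp (blinfun_apply f2 v) \<partial>\<gamma>)"
    by simp
  also have "\<dots> = complex_of_real (exp (- ((\<integral>v. (blinfun_apply f1 v)\<^sup>2 \<partial>\<gamma>) + (\<integral>v. (blinfun_apply f2 v)\<^sup>2 \<partial>\<gamma>)) / 2))"
    unfolding char_functional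
    by (simp add: exp_add[symmetric] add_divide_distrib of_real_mult[symmetric] del: of_real_mult)
  finally show ?thesis .
qed

text \<open>
  By independence the variance of \<open>f1 u + f2 v\<close> is the sum of the two variances, and the parallelogram
  identity shows that the rotation by 45 degrees preserves this sum.
\<close>
lemma rotation_invariance:
  defines "R \<equiv> \<lambda>(u, v). ((1 / sqrt 2) *\<^sub>R (u - v :: 'a), (1 / sqrt 2) *\<^sub>R (u + v))"
  shows "distr (\<gamma> \<Otimes>\<^sub>M \<gamma>) (\<gamma> \<Otimes>\<^sub>M \<gamma>) R = \<gamma> \<Otimes>\<^sub>M \<gamma>"
proof -
  interpret P: pair_prob_space \<gamma> \<gamma> ..
  have sets [measurable_cong]: "sets (\<gamma> \<Otimes>\<^sub>M \<gamma>) = sets (borel :: ('a \<times> 'a) measure)"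
    unfolding borel_prod[symmetric] by (intro sets_pair_measure_cong sets_eq_borel)
  have R: "bounded_linear R"
    unfolding R_def case_prod_unfold
    by (intro bounded_linear_Pair bounded_linear_scaleR_right[THEN bounded_linear_compose]
        bounded_linear_sub bounded_linear_add bounded_linear_fst bounded_linear_snd)
  have Rm [measurable]: "R \<in> borel_measurable borel"
    by (intro borel_measurable_continuous_onI linear_continuous_on R)
  have "distr (\<gamma> \<Otimes>\<^sub>M \<gamma>) borel R = \<gamma> \<Otimes>\<^sub>M \<gamma>"
  proof (rule measure_eqI_char_functional)
    fix F :: "('a \<times> 'a) \<Rightarrow>\<^sub>L real"
    define f1 where "f1 = F o\<^sub>L Blinfun (\<lambda>u. (u, 0))"
    define f2 where "f2 = F o\<^sub>L Blinfun (\<lambda>v. (0, v))"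
    have bl: "bounded_linear (\<lambda>u::'a. (u, 0::'a))" "bounded_linear (\<lambda>v::'a. (0::'a, v))"
      by (intro bounded_linear_Pair bounded_linear_ident bounded_linear_zero)+
    have F: "blinfun_apply F (u, v) = blinfun_apply f1 u + blinfun_apply f2 v" for u v
      using blinfun.add_right[of F "(u, 0)" "(0, v)"]
      by (simp add: f1_def f2_def bounded_linear_Blinfun_apply[OF bl(1)] bounded_linear_Blinfun_apply[OF bl(2)])
    let ?c = "1 / sqrt 2"
    have FR: "blinfun_apply (F o\<^sub>L Blinfun R) (u, v)
        = blinfun_apply (?c *\<^sub>R (f1 + f2)) u + blinfun_apply (?c *\<^sub>R (f2 - f1)) v" for u v
      by (simp add: bounded_linear_Blinfun_apply[OF R], simp add: R_def F blinfun.add_right blinfun.diff_right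
          blinfun.scaleR_right blinfun.add_left blinfun.diff_left blinfun.scaleR_left algebra_simps add_divide_distrib diff_divide_distrib)
    let ?q = "\<lambda>f :: 'a \<Rightarrow>\<^sub>L real. \<integral>v. (blinfun_apply f v)\<^sup>2 \<partial>\<gamma>"
    have "?q (?c *\<^sub>R (f1 + f2)) + ?q (?c *\<^sub>R (f2 - f1))
        = (\<integral>v. (blinfun_apply (?c *\<^sub>R (f1 + f2)) v)\<^sup>2 + (blinfun_apply (?c *\<^sub>R (f2 - f1)) v)\<^sup>2 \<partial>\<gamma>)"
      by (intro Bochner_Integration.integral_add[symmetric] integrable_functional_square)
    also have "\<dots> = (\<integral>v. (blinfun_apply f1 v)\<^sup>2 + (blinfun_apply f2 v)\<^sup>2 \<partial>\<gamma>)"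
      by (intro Bochner_Integration.integral_cong refl)
        (simp add: blinfun.add_left blinfun.diff_left blinfun.scaleR_left power_divide power2_sum power2_diff
          add_divide_distrib[symmetric])
    also have "\<dots> = ?q f1 + ?q f2"
      by (intro Bochner_Integration.integral_add integrable_functional_square)
    finally have q: "?q (?c *\<^sub>R (f1 + f2)) + ?q (?c *\<^sub>R (f2 - f1)) = ?q f1 + ?q f2" .
    have "(\<integral>p. iexp (blinfun_apply F p) \<partial>distr (\<gamma> \<Otimes>\<^sub>M \<gamma>) borel R)
        = (\<integral>p. iexp (blinfun_apply (F o\<^sub>L Blinfun R) p) \<partial>(\<gamma> \<Otimes>\<^sub>M \<gamma>))"
      by (subst integral_distr) (auto simp: bounded_linear_Blinfun_apply[OF R])
    also have "\<dots> = (\<integral>p. iexp (blinfun_apply F p) \<partial>(\<gamma> \<Otimes>\<^sub>M \<gamma>))"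
      unfolding char_functional_pair[OF F] char_functional_pair[OF FR] q ..
    finally show "(\<integral>p. iexp (blinfun_apply F p) \<partial>distr (\<gamma> \<Otimes>\<^sub>M \<gamma>) borel R)
        = (\<integral>p. iexp (blinfun_apply F p) \<partial>(\<gamma> \<Otimes>\<^sub>M \<gamma>))" .
  qed (auto intro!: P.prob_space_distr P.prob_space_axioms sets)
  then show ?thesis by (metis distr_cong sets)
qed

text \<open>
  Fernique's inequality. By rotation invariance the left-hand side is the probability that
  \<open>norm (u - v) \<le> sqrt 2 * s\<close> and \<open>norm (u + v) > sqrt 2 * (sqrt 2 * t + s)\<close> for independent \<open>u\<close>, \<open>v\<close>
  with law \<open>\<gamma>\<close>, and the triangle inequality then forces both \<open>u\<close> and \<open>v\<close> to have norm above \<open>t\<close>.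
\<close>
lemma tail_prob_square_bound:
  "prob {v. norm v \<le> s} * prob {v. norm v > sqrt 2 * t + s} \<le> (prob {v. norm v > t})\<^sup>2"
proof -
  interpret P: pair_prob_space \<gamma> \<gamma> ..
  define R where "R = (\<lambda>(u, v). ((1 / sqrt 2) *\<^sub>R (u - v :: 'a), (1 / sqrt 2) *\<^sub>R (u + v)))"
  have [measurable]: "R \<in> (\<gamma> \<Otimes>\<^sub>M \<gamma>) \<rightarrow>\<^sub>M (\<gamma> \<Otimes>\<^sub>M \<gamma>)"
    unfolding R_def by measurable
  have rect: "P.prob (A \<times> B) = prob A * prob B" if "A \<in> sets \<gamma>" "B \<in> sets \<gamma>" for A B
    using emeasure_pair_measure_Times[OF that]
    by (simp add: P.emeasure_eq_measure emeasure_eq_measure ennreal_mult[symmetric])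
  let ?C = "{v. norm v \<le> s} \<times> {v. norm v > sqrt 2 * t + s}"
  let ?D = "{v::'a. norm v > t} \<times> {v. norm v > t}"
  have "prob {v. norm v \<le> s} * prob {v. norm v > sqrt 2 * t + s} = P.prob ?C"
    by (rule rect[symmetric]) measurable
  also have "\<dots> = measure (distr (\<gamma> \<Otimes>\<^sub>M \<gamma>) (\<gamma> \<Otimes>\<^sub>M \<gamma>) R) ?C"
    using rotation_invariance by (simp add: R_def)
  also have "\<dots> = P.prob (R -` ?C \<inter> space (\<gamma> \<Otimes>\<^sub>M \<gamma>))"
    by (rule measure_distr) measurable
  also have "\<dots> \<le> P.prob ?D"
  proof (rule P.finite_measure_mono)
    show "?D \<in> sets (\<gamma> \<Otimes>\<^sub>M \<gamma>)" by measurable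
    have big: "norm w > t" if w: "sqrt 2 *\<^sub>R w = b + c" "norm b > sqrt 2 * t + s" "norm c \<le> s" for w b c :: 'a
    proof -
      have "sqrt 2 * norm w = norm (b + c)" using w(1)[symmetric] by simp
      also have "\<dots> \<ge> norm b - norm c" using norm_diff_ineq by blast
      finally have "sqrt 2 * t < sqrt 2 * norm w" using w by linarith
      then show ?thesis by simp
    qed
    show "R -` ?C \<inter> space (\<gamma> \<Otimes>\<^sub>M \<gamma>) \<subseteq> ?D"
    proof
      fix p assume p: "p \<in> R -` ?C \<inter> space (\<gamma> \<Otimes>\<^sub>M \<gamma>)"
      obtain u v where uv: "p = (u, v)" by (cases p)
      from p have n: "norm ((1 / sqrt 2) *\<^sub>R (u - v)) \<le> s" "norm ((1 / sqrt 2) *\<^sub>R (u + v)) > sqrt 2 * t + s"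
        by (auto simp: R_def uv)
      have r2: "(1 / sqrt 2) *\<^sub>R (2 *\<^sub>R w) = sqrt 2 *\<^sub>R w" for w :: 'a
        by (simp add: real_div_sqrt)
      have "(1 / sqrt 2) *\<^sub>R (u + v) + (1 / sqrt 2) *\<^sub>R (u - v) = (1 / sqrt 2) *\<^sub>R (2 *\<^sub>R u)"
        unfolding scaleR_add_right[symmetric] scaleR_2 by simp
      then have "sqrt 2 *\<^sub>R u = (1 / sqrt 2) *\<^sub>R (u + v) + (1 / sqrt 2) *\<^sub>R (u - v)"
        unfolding r2 by (rule sym)
      moreover have "(1 / sqrt 2) *\<^sub>R (u + v) - (1 / sqrt 2) *\<^sub>R (u - v) = (1 / sqrt 2) *\<^sub>R (2 *\<^sub>R v)"
        unfolding scaleR_diff_right[symmetric] scaleR_2 by simp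
      then have "sqrt 2 *\<^sub>R v = (1 / sqrt 2) *\<^sub>R (u + v) + - ((1 / sqrt 2) *\<^sub>R (u - v))"
        unfolding r2 by simp
      moreover have "norm (- ((1 / sqrt 2) *\<^sub>R (u - v))) \<le> s" using n(1) by (simp only: norm_minus_cancel)
      ultimately show "p \<in> ?D" unfolding uv using big[OF _ n(2)] n(1) by blast
    qed
  qed
  also have "\<dots> = (prob {v. norm v > t})\<^sup>2"
    unfolding power2_eq_square by (rule rect) measurable
  finally show ?thesis .
qed

text \<open>
  Weak form of Fernique's theorem. Once \<open>s\<close> is so large that the tail \<open>N s\<close> is below \<open>1/20\<close>, Fernique's
  inequality gives \<open>N (3 * u) \<le> N u / 18\<close> for \<open>u \<ge> s\<close>. Tripling the radius multiplies the square by \<open>9\<close>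
  and the probability by at most \<open>1/18\<close>, so the second moment is dominated by a geometric series with
  ratio \<open>1/2\<close>.
\<close>
theorem integrable_norm_square: "integrable \<gamma> (\<lambda>v. (norm v)\<^sup>2)"
proof -
  define N where "N t = prob {v. norm v > t}" for t
  have N_mono: "N t \<le> N s" if "s \<le> t" for s t
    unfolding N_def using that by (intro finite_measure_mono) auto
  have N0: "N t \<ge> 0" "N t \<le> 1" for t by (auto simp: N_def)
  have "(\<lambda>n. prob {v. norm v > real n}) \<longlonglongrightarrow> prob (\<Inter>n::nat. {v. norm v > real n})"
    by (rule finite_Lim_measure_decseq) (auto simp: decseq_def)
  moreover have "(\<Inter>n::nat. {v :: 'a. norm v > real n}) = {}"
  proof -
    have "\<exists>n. \<not> norm v > real n" for v :: 'a
      using reals_Archimedean2[of "norm v"] by (meson less_asym)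
    then show ?thesis by blast
  qed
  ultimately have "(\<lambda>n. N (real n)) \<longlonglongrightarrow> 0" by (simp add: N_def)
  then have "\<forall>\<^sub>F n in sequentially. N (real n) < 1/20" by (rule order_tendstoD) simp
  then obtain n0 where "\<And>n. n \<ge> n0 \<Longrightarrow> N (real n) < 1/20"
    unfolding eventually_sequentially by blast
  then have "N (real (Suc n0)) < 1/20" "real (Suc n0) > 0" by (simp_all del: of_nat_Suc)
  then obtain s :: real where s: "s > 0" "N s < 1/20" by blast
  have Ps: "prob {v. norm v \<le> s} = 1 - N s"
  proof -
    have "{v::'a. norm v \<le> s} = space \<gamma> - {v. norm v > s}" by auto
    then show ?thesis unfolding N_def by (simp only:) (rule prob_compl, measurable)
  qed
  have step: "N (3 * u) \<le> N u / 18" if u: "u \<ge> s" for u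
  proof -
    have "sqrt 2 * u + s \<le> 2 * u + u"
      using u s(1) by (intro add_mono mult_right_mono real_le_lsqrt) auto
    then have "N (3 * u) \<le> N (sqrt 2 * u + s)" by (intro N_mono) simp
    then have "(1 - N s) * N (3 * u) \<le> (1 - N s) * N (sqrt 2 * u + s)"
      using s by (intro mult_left_mono) auto
    also have "\<dots> \<le> (N u)\<^sup>2"
      using tail_prob_square_bound[of s u] unfolding Ps N_def .
    also have "\<dots> \<le> N u * (1/20)"
      unfolding power2_eq_square using N_mono[OF u] s N0 by (intro mult_left_mono) auto
    finally have "(1 - N s) * N (3 * u) \<le> N u / 20" by simp
    moreover have "(19/20) * N (3 * u) \<le> (1 - N s) * N (3 * u)"
      using s N0 by (intro mult_right_mono) auto
    ultimately show ?thesis using N0[of u] by simp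
  qed
  have geo: "N (3 ^ n * s) \<le> (1/18) ^ n" for n
  proof (induction n)
    case (Suc n)
    have "1 * s \<le> 3 ^ n * s" using s(1) by (intro mult_right_mono) auto
    from step[of "3 ^ n * s"] this Suc show ?case by (simp add: mult.assoc)
  qed (use N0 in auto)
  have pt: "ennreal ((norm v)\<^sup>2) \<le> ennreal (s\<^sup>2)
      + (\<Sum>n. ennreal (9 ^ Suc n * s\<^sup>2) * indicator {v. norm v > 3 ^ n * s} v)" for v :: 'a
  proof (cases "norm v \<le> s")
    case True
    then have "ennreal ((norm v)\<^sup>2) \<le> ennreal (s\<^sup>2)" using s by (intro ennreal_leI power_mono) auto
    then show ?thesis by (simp add: add_increasing2)
  next
    case False
    obtain m :: nat where "norm v / s < 3 ^ m" using real_arch_pow[of 3 "norm v / s"] by auto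
    then have ex: "norm v \<le> 3 ^ m * s" using s by (simp add: pos_divide_less_eq)
    \<comment> \<open>The summand that dominates \<open>(norm v)\<^sup>2\<close> is the one of the shell
      \<open>3 ^ n * s < norm v \<le> 3 ^ Suc n * s\<close> which contains \<open>v\<close>.\<close>
    define k where "k = (LEAST k. norm v \<le> 3 ^ k * s)"
    have k: "norm v \<le> 3 ^ k * s" unfolding k_def by (rule LeastI) (rule ex)
    then have "k \<noteq> 0" using False by (intro notI) simp
    then obtain n where n: "k = Suc n" using not0_implies_Suc by blast
    have gt: "norm v > 3 ^ n * s"
      using not_less_Least[of n "\<lambda>k. norm v \<le> 3 ^ k * s"] n unfolding k_def[symmetric] by simp
    have "(norm v)\<^sup>2 \<le> (3 ^ k * s)\<^sup>2" using k by (intro power_mono) auto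
    also have "\<dots> = 9 ^ Suc n * s\<^sup>2"
      by (simp add: n power_mult_distrib power_mult[symmetric] mult.commute[of _ 2])
        (simp add: power_mult)
    finally have "ennreal ((norm v)\<^sup>2)
        \<le> ennreal (9 ^ Suc n * s\<^sup>2) * indicator {v. norm v > 3 ^ n * s} v"
      using gt by (simp add: ennreal_leI)
    also have "\<dots> \<le> (\<Sum>n. ennreal (9 ^ Suc n * s\<^sup>2) * indicator {v. norm v > 3 ^ n * s} v)"
    proof -
      have "h n \<le> suminf h" for h :: "nat \<Rightarrow> ennreal"
        using sum_le_suminf[OF summableI, of "{n}" h] by simp
      then show ?thesis .
    qed
    finally show ?thesis by (simp add: add_increasing)
  qed
  have "(\<integral>\<^sup>+v. ennreal ((norm v)\<^sup>2) \<partial>\<gamma>) \<le> (\<integral>\<^sup>+v. ennreal (s\<^sup>2)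
      + (\<Sum>n. ennreal (9 ^ Suc n * s\<^sup>2) * indicator {v. norm v > 3 ^ n * s} v) \<partial>\<gamma>)"
    by (intro nn_integral_mono pt)
  also have "\<dots> = ennreal (s\<^sup>2) + (\<Sum>n. ennreal (9 ^ Suc n * s\<^sup>2) * emeasure \<gamma> {v. norm v > 3 ^ n * s})"
    by (subst nn_integral_add, simp, measurable)
       (subst nn_integral_suminf, auto simp: nn_integral_cmult_indicator emeasure_space_1[simplified])
  also have "\<dots> \<le> ennreal (s\<^sup>2) + (\<Sum>n. ennreal (9 * s\<^sup>2 * (1/2) ^ n))"
  proof (intro add_left_mono suminf_le summableI)
    fix n
    have "ennreal (9 ^ Suc n * s\<^sup>2) * emeasure \<gamma> {v. norm v > 3 ^ n * s}
        = ennreal (9 ^ Suc n * s\<^sup>2 * N (3 ^ n * s))"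
      by (simp add: N_def emeasure_eq_measure ennreal_mult)
    also have "\<dots> \<le> ennreal (9 ^ Suc n * s\<^sup>2 * (1/18) ^ n)"
      by (intro ennreal_leI mult_left_mono geo) auto
    also have "9 ^ Suc n * s\<^sup>2 * (1/18) ^ n = 9 * s\<^sup>2 * (1/2) ^ n"
    proof -
      have "(9::real) ^ n * (1/18) ^ n = (1/2) ^ n" by (simp add: power_mult_distrib[symmetric])
      then show ?thesis by (simp add: mult_ac)
    qed
    finally show "ennreal (9 ^ Suc n * s\<^sup>2) * emeasure \<gamma> {v. norm v > 3 ^ n * s} \<le> ennreal (9 * s\<^sup>2 * (1/2) ^ n)" .
  qed
  also have "\<dots> < \<infinity>"
  proof -
    have "summable (\<lambda>n. 9 * s\<^sup>2 * (1/2::real) ^ n)" by (intro summable_mult summable_geometric) auto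
    then have "(\<Sum>n. ennreal (9 * s\<^sup>2 * (1/2) ^ n)) = ennreal (\<Sum>n. 9 * s\<^sup>2 * (1/2) ^ n)"
      by (intro suminf_ennreal2) auto
    then show ?thesis by (simp add: less_top[symmetric])
  qed
  finally show ?thesis by (intro integrableI_bounded) auto
qed

end

section \<open>Almost sure convergence of orthonormal expansions\<close>

context centered_gaussian
begin

lemma functional_bound: "\<bar>blinfun_apply f v\<bar> \<le> norm f * norm v" for f :: "'a \<Rightarrow>\<^sub>L real"
  using norm_blinfun[of f v] by simp

lemma integrable_functional_mult:
  fixes f g :: "'a \<Rightarrow>\<^sub>L real"
  shows "integrable \<gamma> (\<lambda>v. blinfun_apply f v * blinfun_apply g v)"
proof (rule Bochner_Integration.integrable_bound)
  show "integrable \<gamma> (\<lambda>v. (norm f * norm g) * (norm v)\<^sup>2)"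
    using integrable_norm_square by simp
  have "\<bar>blinfun_apply f v * blinfun_apply g v\<bar> \<le> (norm f * norm v) * (norm g * norm v)" for v
    unfolding abs_mult by (intro mult_mono functional_bound) auto
  then show "AE v in \<gamma>. norm (blinfun_apply f v * blinfun_apply g v)
      \<le> norm ((norm f * norm g) * (norm v)\<^sup>2)"
    by (simp add: power2_eq_square mult_ac abs_mult)
qed measurable

text \<open>
  Square integrability of the norm makes \<open>cov_op \<gamma> f\<close> a genuine Bochner integral, hence compatible with
  bounded linear maps; this is what turns it into the covariance of functionals below.
\<close>
lemma integrable_cov_op_integrand:
  fixes f :: "'a \<Rightarrow>\<^sub>L real"
  shows "integrable \<gamma> (\<lambda>v. blinfun_apply f v *\<^sub>R v)"
proof (rule Bochner_Integration.integrable_bound)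
  show "integrable \<gamma> (\<lambda>v. norm f * (norm v)\<^sup>2)"
    using integrable_norm_square by simp
  have "norm (blinfun_apply f v *\<^sub>R v) \<le> (norm f * norm v) * norm v" for v
    unfolding norm_scaleR by (intro mult_right_mono functional_bound) auto
  then show "AE v in \<gamma>. norm (blinfun_apply f v *\<^sub>R v) \<le> norm (norm f * (norm v)\<^sup>2)"
    by (simp add: power2_eq_square mult_ac abs_mult)
qed measurable

lemma blinfun_cov_op:
  fixes f :: "'a \<Rightarrow>\<^sub>L real" and A :: "'a \<Rightarrow>\<^sub>L 'b::{banach,second_countable_topology}"
  shows "blinfun_apply A (cov_op \<gamma> f) = (\<integral>v. blinfun_apply f v *\<^sub>R blinfun_apply A v \<partial>\<gamma>)"
  unfolding cov_op_def
  using integral_bounded_linear[OF blinfun.bounded_linear_right integrable_cov_op_integrand, of A f]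
  by (simp add: blinfun.scaleR_right)

lemma functional_cov_op:
  fixes f g :: "'a \<Rightarrow>\<^sub>L real"
  shows "blinfun_apply g (cov_op \<gamma> f) = (\<integral>v. blinfun_apply f v * blinfun_apply g v \<partial>\<gamma>)"
  by (simp add: blinfun_cov_op)

end

text \<open>
  The vectors \<open>h k\<close> form an orthonormal system of the Cameron--Martin space, since its inner product
  of \<open>cov_op \<gamma> f\<close> and \<open>cov_op \<gamma> g\<close> is the \<open>L^2(\<gamma>)\<close> product of \<open>f\<close> and \<open>g\<close>. Speaking of functionals
  instead keeps that space out of the argument.
\<close>
locale orthonormal_functionals = centered_gaussian \<gamma>
  for \<gamma> :: "'a::{banach,second_countable_topology} measure" +
  fixes e :: "nat \<Rightarrow> 'a \<Rightarrow>\<^sub>L real"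
  assumes orthonormal:
    "(\<integral>v. blinfun_apply (e j) v * blinfun_apply (e k) v \<partial>\<gamma>) = (if j = k then 1 else 0)"
begin

definition h :: "nat \<Rightarrow> 'a" where "h k = cov_op \<gamma> (e k)"

definition block :: "nat \<Rightarrow> nat \<Rightarrow> 'a \<Rightarrow>\<^sub>L 'a" where
  "block m n = (\<Sum>k\<in>{m..<n}. blinfun_scaleR_left (h k) o\<^sub>L e k)"

definition tail :: "nat \<Rightarrow> 'a \<Rightarrow>\<^sub>L 'a" where
  "tail n = id_blinfun - block 0 n"

text \<open>
  The map that reverses the sign of the coordinates \<open>m\<close> to \<open>n - 1\<close>.
\<close>
definition reflection :: "nat \<Rightarrow> nat \<Rightarrow> 'a \<Rightarrow>\<^sub>L 'a" where
  "reflection m n = id_blinfun - 2 *\<^sub>R block m n"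

lemma block_apply: "blinfun_apply (block m n) v = (\<Sum>k\<in>{m..<n}. blinfun_apply (e k) v *\<^sub>R h k)"
  by (simp add: block_def blinfun.sum_left)

lemma tail_apply: "blinfun_apply (tail n) v = v - blinfun_apply (block 0 n) v"
  by (simp add: tail_def blinfun.diff_left)

lemma reflection_apply:
  "blinfun_apply (reflection m n) v = v - 2 *\<^sub>R blinfun_apply (block m n) v"
  by (simp add: reflection_def blinfun.diff_left blinfun.scaleR_left)

lemma functional_h:
  fixes g :: "'a \<Rightarrow>\<^sub>L real"
  shows "blinfun_apply g (h k) = (\<integral>v. blinfun_apply (e k) v * blinfun_apply g v \<partial>\<gamma>)"
  by (simp add: h_def functional_cov_op)

lemma biorthogonal: "blinfun_apply (e j) (h k) = (if j = k then 1 else 0)"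
  by (auto simp: functional_h orthonormal)

lemma functional_block:
  "blinfun_apply (e j) (blinfun_apply (block m n) v)
    = (if m \<le> j \<and> j < n then blinfun_apply (e j) v else 0)"
  by (simp add: block_apply blinfun.sum_right blinfun.scaleR_right biorthogonal if_distrib
      sum.delta' cong: if_cong)

lemma block_h: "blinfun_apply (block m n) (h k) = (if m \<le> k \<and> k < n then h k else 0)"
  by (simp add: block_apply biorthogonal if_distrib[where f = "\<lambda>c. c *\<^sub>R _"] cong: if_cong)

lemma tail_split:
  assumes "m \<le> n"
  shows "blinfun_apply (tail m) v = blinfun_apply (block m n) v + blinfun_apply (tail n) v"
proof -
  have "blinfun_apply (block 0 n) v = blinfun_apply (block 0 m) v + blinfun_apply (block m n) v"
    unfolding block_apply using assms by (simp add: sum.atLeastLessThan_concat)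
  then show ?thesis by (simp add: tail_apply)
qed

lemma integral_block_mult:
  fixes f g :: "'a \<Rightarrow>\<^sub>L real"
  shows "(\<integral>v. blinfun_apply g (blinfun_apply (block m n) v) * blinfun_apply f v \<partial>\<gamma>)
    = (\<Sum>k\<in>{m..<n}. blinfun_apply g (h k) * blinfun_apply f (h k))"
proof -
  have "(\<integral>v. blinfun_apply g (blinfun_apply (block m n) v) * blinfun_apply f v \<partial>\<gamma>)
     = (\<integral>v. (\<Sum>k\<in>{m..<n}. blinfun_apply g (h k) * (blinfun_apply (e k) v * blinfun_apply f v)) \<partial>\<gamma>)"
    by (simp add: block_apply blinfun.sum_right blinfun.scaleR_right sum_distrib_left sum_distrib_right mult_ac)
  also have "\<dots> = (\<Sum>k\<in>{m..<n}. blinfun_apply g (h k) * blinfun_apply f (h k))"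
    by (subst Bochner_Integration.integral_sum) (simp_all add: integrable_functional_mult functional_h)
  finally show ?thesis .
qed

lemma integral_block_square:
  fixes g :: "'a \<Rightarrow>\<^sub>L real"
  shows "(\<integral>v. (blinfun_apply g (blinfun_apply (block m n) v))\<^sup>2 \<partial>\<gamma>)
    = (\<Sum>k\<in>{m..<n}. (blinfun_apply g (h k))\<^sup>2)"
  using integral_block_mult[of g m n "g o\<^sub>L block m n"]
  by (simp add: power2_eq_square block_h)

text \<open>
  The coefficient \<open>c\<^sup>2 - 2 * c\<close> vanishes for \<open>c = 2\<close>, which is the invariance of variances under
  reflections, and equals \<open>-1\<close> for \<open>c = 1\<close>, which gives the variance of the remainder after \<open>n\<close> terms when \<open>m = 0\<close>.
\<close>
lemma integral_scaled_block_square: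
  fixes g :: "'a \<Rightarrow>\<^sub>L real"
  shows "(\<integral>v. (blinfun_apply g (v - c *\<^sub>R blinfun_apply (block m n) v))\<^sup>2 \<partial>\<gamma>)
    = (\<integral>v. (blinfun_apply g v)\<^sup>2 \<partial>\<gamma>) + (c\<^sup>2 - 2 * c) * (\<Sum>k\<in>{m..<n}. (blinfun_apply g (h k))\<^sup>2)"
proof -
  have i: "integrable \<gamma> (\<lambda>v. (blinfun_apply g v)\<^sup>2)"
    "integrable \<gamma> (\<lambda>v. blinfun_apply g (blinfun_apply (block m n) v) * blinfun_apply g v)"
    "integrable \<gamma> (\<lambda>v. (blinfun_apply g (blinfun_apply (block m n) v))\<^sup>2)"
    using integrable_functional_square[of g] integrable_functional_mult[of "g o\<^sub>L block m n" g]
      integrable_functional_square[of "g o\<^sub>L block m n"] by simp_all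
  have "(\<integral>v. (blinfun_apply g (v - c *\<^sub>R blinfun_apply (block m n) v))\<^sup>2 \<partial>\<gamma>)
    = (\<integral>v. (blinfun_apply g v)\<^sup>2
        - 2 * c * (blinfun_apply g (blinfun_apply (block m n) v) * blinfun_apply g v)
        + c\<^sup>2 * (blinfun_apply g (blinfun_apply (block m n) v))\<^sup>2 \<partial>\<gamma>)"
    by (intro Bochner_Integration.integral_cong refl)
      (simp add: blinfun.diff_right blinfun.scaleR_right power2_diff power_mult_distrib mult_ac)
  also have "\<dots> = (\<integral>v. (blinfun_apply g v)\<^sup>2 \<partial>\<gamma>)
       - 2 * c * (\<Sum>k\<in>{m..<n}. (blinfun_apply g (h k))\<^sup>2)
       + c\<^sup>2 * (\<Sum>k\<in>{m..<n}. (blinfun_apply g (h k))\<^sup>2)"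
  proof -
    have "(\<integral>v. blinfun_apply g (blinfun_apply (block m n) v) * blinfun_apply g v \<partial>\<gamma>)
        = (\<Sum>k\<in>{m..<n}. (blinfun_apply g (h k))\<^sup>2)"
      by (simp add: integral_block_mult power2_eq_square)
    then show ?thesis using i by (simp add: integral_block_square)
  qed
  finally show ?thesis by (simp add: algebra_simps)
qed

lemma distr_reflection: "distr \<gamma> borel (blinfun_apply (reflection m n)) = \<gamma>"
  by (rule distr_eq_if_variance_eq)
    (simp add: reflection_apply integral_scaled_block_square)

lemma prob_reflection:
  assumes "A \<in> sets borel"
  shows "prob {v. blinfun_apply (reflection m n) v \<in> A} = prob A"
proof -
  have "prob A = measure (distr \<gamma> borel (blinfun_apply (reflection m n))) A"
    by (simp add: distr_reflection)
  also have "\<dots> = prob {v. blinfun_apply (reflection m n) v \<in> A}"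
    using assms by (subst measure_distr) (auto simp: vimage_def)
  finally show ?thesis by simp
qed

lemma tail_reflection:
  assumes "n \<le> k"
  shows "blinfun_apply (tail k) (blinfun_apply (reflection m n) v) = blinfun_apply (tail k) v"
proof -
  have "blinfun_apply (block 0 k) (blinfun_apply (block m n) v) = blinfun_apply (block m n) v"
    using assms
    by (subst (2) block_apply)
      (simp add: blinfun.sum_right blinfun.scaleR_right block_h, simp add: block_apply)
  then show ?thesis
    by (simp add: tail_apply reflection_apply blinfun.diff_right blinfun.scaleR_right)
qed

text \<open>
  With \<open>D\<close> the block from \<open>m\<close> to \<open>n - 1\<close>, the \<open>m\<close>-th tail is the \<open>n\<close>-th tail plus \<open>D\<close> at \<open>v\<close>,
  and the \<open>n\<close>-th tail minus \<open>D\<close> at the reflected vector.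
\<close>
lemma tail_midpoint:
  assumes "m \<le> n"
  shows "blinfun_apply (tail n) v = (1/2) *\<^sub>R
    (blinfun_apply (tail m) v + blinfun_apply (tail m) (blinfun_apply (reflection m n) v))"
proof -
  have "blinfun_apply (block 0 m) (blinfun_apply (block m n) v) = 0"
    by (subst (2) block_apply) (simp add: blinfun.sum_right blinfun.scaleR_right block_h)
  then have "blinfun_apply (tail m) (blinfun_apply (reflection m n) v)
      = blinfun_apply (tail m) v - 2 *\<^sub>R blinfun_apply (block m n) v"
    by (simp add: tail_apply reflection_apply blinfun.diff_right blinfun.scaleR_right)
  then show ?thesis
    using tail_split[OF assms, of v] by (simp add: scaleR_diff_right scaleR_add_right scaleR_2 flip: scaleR_left.add)
qed

text \<open>
  Levy's maximal inequality for the tails, decomposed according to the last index \<open>n\<close> at which the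
  norm exceeds \<open>t\<close>. The event \<open>E n\<close> depends on tails from \<open>n\<close> on only, hence is invariant under
  \<open>reflection m n\<close>. On \<open>E n\<close>, by the midpoint formula, the \<open>m\<close>-th tail of \<open>v\<close> or that of its
  reflection has norm above \<open>t\<close>, and both possibilities have the same probability.
\<close>
lemma prob_tail_maximal:
  "prob {v. \<exists>n\<in>{m..N}. norm (blinfun_apply (tail n) v) > t}
    \<le> 2 * prob {v. norm (blinfun_apply (tail m) v) > t}"
proof -
  let ?T = "\<lambda>n v. norm (blinfun_apply (tail n) v)"
  define F where "F = {v. ?T m v > t}"
  define E where "E n = {v. ?T n v > t \<and> (\<forall>k\<in>{n<..N}. ?T k v \<le> t)}" for n
  have E_b [measurable]: "E n \<in> sets borel" for n unfolding E_def by measurable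
  have F_b [measurable]: "F \<in> sets borel" unfolding F_def by measurable
  have disj: "disjoint_family_on E {m..N}"
    unfolding disjoint_family_on_def E_def by (auto) (metis greaterThanAtMost_iff linorder_neqE_nat not_le)
  have step: "prob (E n) \<le> 2 * prob (E n \<inter> F)" if n: "n \<in> {m..N}" for n
  proof -
    have "E n \<subseteq> (E n \<inter> F) \<union> {v. blinfun_apply (reflection m n) v \<in> E n \<inter> F}"
    proof
      fix v assume v: "v \<in> E n"
      then have rv: "blinfun_apply (reflection m n) v \<in> E n"
        unfolding E_def by (simp add: tail_reflection)
      have "?T n v = norm (blinfun_apply (tail m) v + blinfun_apply (tail m) (blinfun_apply (reflection m n) v)) / 2"
        using tail_midpoint[of m n v] n by simp
      also have "\<dots> \<le> (?T m v + ?T m (blinfun_apply (reflection m n) v)) / 2"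
        by (intro divide_right_mono norm_triangle_ineq) simp
      finally have "?T m v > t \<or> ?T m (blinfun_apply (reflection m n) v) > t"
        using v unfolding E_def by force
      then show "v \<in> (E n \<inter> F) \<union> {v. blinfun_apply (reflection m n) v \<in> E n \<inter> F}"
        using v rv by (auto simp: F_def)
    qed
    then have "prob (E n) \<le> prob ((E n \<inter> F) \<union> {v. blinfun_apply (reflection m n) v \<in> E n \<inter> F})"
      by (rule finite_measure_mono) measurable
    also have "\<dots> \<le> prob (E n \<inter> F) + prob {v. blinfun_apply (reflection m n) v \<in> E n \<inter> F}"
      by (rule measure_Un_le) measurable
    also have "prob {v. blinfun_apply (reflection m n) v \<in> E n \<inter> F} = prob (E n \<inter> F)"
      by (rule prob_reflection) measurable
    finally show ?thesis by simp
  qed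
  have "{v. \<exists>n\<in>{m..N}. ?T n v > t} \<subseteq> (\<Union>n\<in>{m..N}. E n)"
  proof
    fix v assume "v \<in> {v. \<exists>n\<in>{m..N}. ?T n v > t}"
    then have ne: "{n\<in>{m..N}. ?T n v > t} \<noteq> {}" by auto
    let ?n = "Max {n\<in>{m..N}. ?T n v > t}"
    have n: "?n \<in> {n\<in>{m..N}. ?T n v > t}" by (rule Max_in[OF _ ne]) simp
    have "?T k v \<le> t" if "k \<in> {?n<..N}" for k
    proof (rule ccontr)
      assume "\<not> ?thesis"
      then have "k \<in> {n\<in>{m..N}. ?T n v > t}" using that n by auto
      then have "k \<le> ?n" by (intro Max_ge) auto
      then show False using that by simp
    qed
    then have "v \<in> E ?n" using n unfolding E_def by blast
    then show "v \<in> (\<Union>n\<in>{m..N}. E n)" using n by blast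
  qed
  then have "prob {v. \<exists>n\<in>{m..N}. ?T n v > t} \<le> prob (\<Union>n\<in>{m..N}. E n)"
    by (rule finite_measure_mono) measurable
  also have "\<dots> = (\<Sum>n\<in>{m..N}. prob (E n))"
    using disj by (intro finite_measure_finite_Union) auto
  also have "\<dots> \<le> (\<Sum>n\<in>{m..N}. 2 * prob (E n \<inter> F))" by (intro sum_mono step)
  also have "\<dots> = 2 * (\<Sum>n\<in>{m..N}. prob (E n \<inter> F))" by (simp add: sum_distrib_left)
  also have "(\<Sum>n\<in>{m..N}. prob (E n \<inter> F)) = prob (\<Union>n\<in>{m..N}. E n \<inter> F)"
    using disj by (intro finite_measure_finite_Union[symmetric])
      (auto simp: disjoint_family_on_def)
  also have "\<dots> \<le> prob F" by (rule finite_measure_mono) auto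
  finally show ?thesis by (simp add: F_def)
qed

lemma prob_tail_sup:
  "prob {v. \<exists>n\<ge>m. norm (blinfun_apply (tail n) v) > t}
    \<le> 2 * prob {v. norm (blinfun_apply (tail m) v) > t}"
proof -
  let ?A = "\<lambda>N. {v. \<exists>n\<in>{m..N}. norm (blinfun_apply (tail n) v) > t}"
  have "(\<lambda>N. prob (?A N)) \<longlonglongrightarrow> prob (\<Union>N. ?A N)"
    by (intro finite_Lim_measure_incseq) (auto simp: incseq_def, measurable)
  moreover have "(\<Union>N. ?A N) = {v. \<exists>n\<ge>m. norm (blinfun_apply (tail n) v) > t}"
    by auto (metis atLeastAtMost_iff order_refl)
  ultimately show ?thesis
    using prob_tail_maximal by (intro LIMSEQ_le_const2[of "\<lambda>N. prob (?A N)"]) auto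
qed

end

text \<open>
  Parseval's identity says that the \<open>h k\<close> are complete in the Cameron--Martin space.
\<close>
locale functional_basis = orthonormal_functionals +
  assumes parseval:
    "\<And>g :: 'a \<Rightarrow>\<^sub>L real. (\<lambda>k. (blinfun_apply g (h k))\<^sup>2) sums (\<integral>v. (blinfun_apply g v)\<^sup>2 \<partial>\<gamma>)"
begin

lemma functional_tail_tendsto_0:
  fixes g :: "'a \<Rightarrow>\<^sub>L real"
  shows "(\<lambda>n. \<integral>v. (blinfun_apply g (blinfun_apply (tail n) v))\<^sup>2 \<partial>\<gamma>) \<longlonglongrightarrow> 0"
proof -
  have "(\<lambda>n. (\<integral>v. (blinfun_apply g v)\<^sup>2 \<partial>\<gamma>) - (\<Sum>k<n. (blinfun_apply g (h k))\<^sup>2)) \<longlonglongrightarrow>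
      (\<integral>v. (blinfun_apply g v)\<^sup>2 \<partial>\<gamma>) - (\<integral>v. (blinfun_apply g v)\<^sup>2 \<partial>\<gamma>)"
    using parseval[of g] by (intro tendsto_intros) (simp add: sums_def)
  then show ?thesis
    using integral_scaled_block_square[of g 1 0] by (simp add: tail_apply lessThan_atLeast0)
qed

text \<open>
  The argument of Ito and Nisio. The \<open>n\<close>-th tail is the midpoint of \<open>v\<close> and \<open>reflection 0 n v\<close>, which
  both have law \<open>\<gamma>\<close>; hence, up to a probability that does not depend on \<open>n\<close>, it lies in a fixed compact
  set \<open>K'\<close>. On a compact set finitely many functionals control the norm up to a small error, and each
  of them tends to zero in mean square along the tails.
\<close>
lemma tail_tendsto_in_prob:
  assumes t: "t > 0"
  shows "(\<lambda>n. prob {v. norm (blinfun_apply (tail n) v) > t}) \<longlonglongrightarrow> 0"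
proof (rule LIMSEQ_I)
  fix r :: real assume r: "0 < r"
  define \<epsilon> where "\<epsilon> = r / 4"
  have \<epsilon>: "\<epsilon> > 0" using r by (simp add: \<epsilon>_def)
  have "emeasure \<gamma> UNIV = (SUP K \<in> {K. K \<subseteq> UNIV \<and> compact K}. emeasure \<gamma> K)"
    using inner_regular[OF sets_eq_borel, of UNIV] by simp
  then have "ennreal (1 - \<epsilon>) < (SUP K \<in> {K. K \<subseteq> UNIV \<and> compact K}. emeasure \<gamma> K)"
    using emeasure_space_1 \<epsilon> by (simp add: ennreal_lessI ennreal_less_one_iff)
  then obtain K where K: "compact K" "ennreal (1 - \<epsilon>) < emeasure \<gamma> K"
    unfolding less_SUP_iff by auto
  have Kb [measurable]: "K \<in> sets borel" using K(1) by (rule borel_compact)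
  have "1 - \<epsilon> < prob K"
    using K(2) unfolding emeasure_eq_measure by (metis ennreal_leI not_le)
  moreover have "prob (- K) = 1 - prob K"
    using prob_compl[of K] Kb sets_eq_borel by (simp add: Compl_eq_Diff_UNIV)
  ultimately have K\<epsilon>: "prob (- K) < \<epsilon>" by simp
  define K' where "K' = (\<lambda>(u, v). (1/2) *\<^sub>R (u + v)) ` (K \<times> K)"
  have "compact K'"
    unfolding K'_def case_prod_unfold
    by (intro compact_continuous_image continuous_intros compact_Times K(1))
  then obtain Y where Y: "finite Y" "K' \<subseteq> (\<Union>y\<in>Y. ball y (t / 4))"
    using t compactE_image[of K' K' "\<lambda>y. ball y (t / 4)"] by (metis (no_types, lifting) UN_I centre_in_ball open_ball subsetI zero_less_divide_iff zero_less_numeral)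
  have "\<exists>g :: 'a \<Rightarrow>\<^sub>L real. norm g \<le> 1 \<and> blinfun_apply g y = norm y" for y
    by (rule norming_functional_exists)
  then obtain g :: "'a \<Rightarrow> 'a \<Rightarrow>\<^sub>L real"
    where g: "\<And>y. norm (g y) \<le> 1" "\<And>y. blinfun_apply (g y) y = norm y" by metis
  have K'_norm: "\<exists>y\<in>Y. \<bar>blinfun_apply (g y) w\<bar> \<ge> t / 2" if "w \<in> K'" "norm w > t" for w
  proof -
    obtain y where y: "y \<in> Y" "norm (y - w) < t / 4"
      using Y(2) \<open>w \<in> K'\<close> by (auto simp: dist_norm)
    have "norm w \<le> norm y + norm (y - w)"
      using norm_triangle_sub[of w y] by (simp add: norm_minus_commute)
    also have "norm y = blinfun_apply (g y) w + blinfun_apply (g y) (y - w)"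
      by (simp add: g(2)[symmetric] blinfun.diff_right)
    also have "blinfun_apply (g y) (y - w) \<le> norm (y - w)"
      using functional_bound[of "g y" "y - w"] mult_right_mono[OF g(1)[of y] norm_ge_zero[of "y - w"]] by simp
    finally have "t / 2 \<le> blinfun_apply (g y) w" using y(2) \<open>norm w > t\<close> by simp
    then show ?thesis using y(1) by force
  qed
  define s where "s n = (\<Sum>y\<in>Y. (\<integral>v. (blinfun_apply (g y) (blinfun_apply (tail n) v))\<^sup>2 \<partial>\<gamma>) / (t / 2)\<^sup>2)" for n
  have "s \<longlonglongrightarrow> (\<Sum>y\<in>Y. 0 / (t / 2)\<^sup>2)"
    unfolding s_def using t by (intro tendsto_intros functional_tail_tendsto_0) auto
  then have "s \<longlonglongrightarrow> 0" by simp
  from order_tendstoD(2)[OF this \<epsilon>] obtain n0 where n0: "\<And>n. n \<ge> n0 \<Longrightarrow> s n < \<epsilon>"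
    unfolding eventually_sequentially by blast
  have bound: "prob {v. norm (blinfun_apply (tail n) v) > t} \<le> 2 * \<epsilon> + s n" for n
  proof -
    let ?B = "\<lambda>y. {v \<in> space \<gamma>. (blinfun_apply (g y) (blinfun_apply (tail n) v))\<^sup>2 \<ge> (t / 2)\<^sup>2}"
    let ?C = "{v. blinfun_apply (reflection 0 n) v \<in> - K}"
    have "{v. norm (blinfun_apply (tail n) v) > t} \<subseteq> (- K \<union> ?C) \<union> (\<Union>y\<in>Y. ?B y)"
    proof
      fix v assume v: "v \<in> {v. norm (blinfun_apply (tail n) v) > t}"
      show "v \<in> (- K \<union> ?C) \<union> (\<Union>y\<in>Y. ?B y)"
      proof (cases "v \<in> K \<and> blinfun_apply (reflection 0 n) v \<in> K")
        case True
        have "blinfun_apply (tail n) v = (1/2) *\<^sub>R (v + blinfun_apply (reflection 0 n) v)"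
          using tail_midpoint[of 0 n v] by (simp add: tail_apply block_apply)
        then have "blinfun_apply (tail n) v \<in> K'" using True unfolding K'_def by force
        then obtain y where "y \<in> Y" "\<bar>blinfun_apply (g y) (blinfun_apply (tail n) v)\<bar> \<ge> t / 2"
          using K'_norm v by blast
        then have "v \<in> ?B y" using t power_mono[of "t / 2" "\<bar>blinfun_apply (g y) (blinfun_apply (tail n) v)\<bar>" 2] by simp
        then show ?thesis using \<open>y \<in> Y\<close> by blast
      qed auto
    qed
    moreover have [measurable]: "?B y \<in> sets \<gamma>" for y by measurable
    have U [measurable]: "(\<Union>y\<in>Y. ?B y) \<in> sets \<gamma>"
      using Y(1) by (intro sets.finite_UN) auto
    ultimately have "prob {v. norm (blinfun_apply (tail n) v) > t} \<le> prob ((- K \<union> ?C) \<union> (\<Union>y\<in>Y. ?B y))"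
      by (intro finite_measure_mono sets.Un U) auto
    also have "\<dots> \<le> prob (- K \<union> ?C) + prob (\<Union>y\<in>Y. ?B y)"
      by (intro measure_Un_le sets.Un U) auto
    also have "prob (- K \<union> ?C) \<le> prob (- K) + prob ?C"
      by (rule measure_Un_le) measurable
    also have "prob ?C = prob (- K)" by (rule prob_reflection) measurable
    also have "prob (\<Union>y\<in>Y. ?B y) \<le> (\<Sum>y\<in>Y. prob (?B y))"
      using Y(1) by (intro measure_UNION_le) auto
    also have "\<dots> \<le> s n"
      unfolding s_def
    proof (rule sum_mono)
      fix y
      show "prob (?B y) \<le> (\<integral>v. (blinfun_apply (g y) (blinfun_apply (tail n) v))\<^sup>2 \<partial>\<gamma>) / (t / 2)\<^sup>2"
        using t integrable_functional_square[of "g y o\<^sub>L tail n"]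
        by (intro integral_Markov_inequality_measure[where A = "{}"]) auto
    qed
    finally show ?thesis using K\<epsilon> by simp
  qed
  have "norm (prob {v. norm (blinfun_apply (tail n) v) > t} - 0) < r" if "n \<ge> n0" for n
    using bound[of n] n0[OF that] r by (simp add: \<epsilon>_def)
  then show "\<exists>no. \<forall>n\<ge>no. norm (prob {v. norm (blinfun_apply (tail n) v) > t} - 0) < r" by blast
qed

text \<open>
  The maximal inequality bounds the probability that tails exceed a level infinitely often by
  twice the probability that the \<open>m\<close>-th one does, for every \<open>m\<close>, and the latter tends to zero.
\<close>
theorem AE_sums: "AE v in \<gamma>. (\<lambda>k. blinfun_apply (e k) v *\<^sub>R h k) sums v"
proof -
  let ?T = "\<lambda>n v. norm (blinfun_apply (tail n) v)"
  have "AE v in \<gamma>. \<exists>m. \<forall>n\<ge>m. ?T n v \<le> 1 / Suc j" for j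
  proof -
    let ?B = "{v. \<forall>m. \<exists>n\<ge>m. ?T n v > 1 / Suc j}"
    have B [measurable]: "?B \<in> sets borel" by measurable
    have lim: "(\<lambda>m. 2 * prob {v. ?T m v > 1 / Suc j}) \<longlonglongrightarrow> 2 * 0"
      by (intro tendsto_intros tail_tendsto_in_prob) simp
    have le: "prob ?B \<le> 2 * prob {v. ?T m v > 1 / Suc j}" for m
    proof -
      have "prob ?B \<le> prob {v. \<exists>n\<ge>m. ?T n v > 1 / Suc j}"
        by (rule finite_measure_mono) (auto, measurable)
      then show ?thesis using prob_tail_sup[of m "1 / Suc j"] by linarith
    qed
    have "prob ?B \<le> 2 * 0" by (rule LIMSEQ_le_const[OF lim]) (use le in blast)
    then have "prob ?B = 0" using measure_nonneg[of \<gamma> ?B] by linarith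
    then have "AE v in \<gamma>. v \<notin> ?B"
      using B sets_eq_borel by (intro AE_not_in) (auto simp: null_sets_def emeasure_eq_measure)
    then show ?thesis by (auto simp: not_less)
  qed
  then have "AE v in \<gamma>. \<forall>j. \<exists>m. \<forall>n\<ge>m. ?T n v \<le> 1 / Suc j" by (simp add: AE_all_countable)
  then show ?thesis
  proof (rule AE_mp, intro AE_I2 impI)
    fix v assume *: "\<forall>j. \<exists>m. \<forall>n\<ge>m. ?T n v \<le> 1 / Suc j"
    have "(\<lambda>n. blinfun_apply (tail n) v) \<longlonglongrightarrow> 0"
    proof (rule LIMSEQ_I)
      fix r :: real assume "0 < r"
      then obtain j :: nat where j: "1 / Suc j < r" using nat_approx_posE by blast
      from * obtain m where "\<forall>n\<ge>m. ?T n v \<le> 1 / Suc j" by blast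
      then show "\<exists>no. \<forall>n\<ge>no. norm (blinfun_apply (tail n) v - 0) < r"
        using j by (intro exI[of _ m]) force
    qed
    from tendsto_diff[OF tendsto_const[of v] this]
    show "(\<lambda>k. blinfun_apply (e k) v *\<^sub>R h k) sums v"
      by (simp add: sums_def tail_apply block_apply lessThan_atLeast0)
  qed
qed

end

section \<open>Independence of the coordinates and law of the random series\<close>

lemma distributed_std_normal_iff:
  "distributed M lborel X (normal_density 0 1) \<longleftrightarrow>
    X \<in> borel_measurable M \<and> distr M borel X = std_normal_distribution"
proof -
  have "distr M lborel X = distr M borel X" by (intro distr_cong) auto
  then show ?thesis by (auto simp: distributed_def)
qed

lemma (in prob_space) char_std_normal_combination:
  fixes \<xi> :: "'i \<Rightarrow> 'a \<Rightarrow> real"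
  assumes indep: "indep_vars (\<lambda>_. borel) \<xi> I"
    and std: "\<And>i. i \<in> I \<Longrightarrow> distr M borel (\<xi> i) = std_normal_distribution"
  shows "(\<integral>\<omega>. iexp (\<Sum>i\<in>I. c i * \<xi> i \<omega>) \<partial>M) = complex_of_real (exp (- (\<Sum>i\<in>I. (c i)\<^sup>2) / 2))"
proof -
  have [measurable]: "i \<in> I \<Longrightarrow> \<xi> i \<in> borel_measurable M" for i
    using indep unfolding indep_vars_def by auto
  have factor: "char (distr M borel (\<lambda>\<omega>. c i * \<xi> i \<omega>)) 1 = complex_of_real (exp (- (c i)\<^sup>2 / 2))"
    if i: "i \<in> I" for i
  proof -
    have [measurable]: "\<xi> i \<in> borel_measurable M" using i by measurable
    have "char (distr M borel (\<lambda>\<omega>. c i * \<xi> i \<omega>)) 1 = char (distr M borel (\<xi> i)) (c i)"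
      by (simp add: char_def integral_distr)
    then show ?thesis using std[OF i] by (simp add: char_std_normal_distribution)
  qed
  have "(\<integral>\<omega>. iexp (\<Sum>i\<in>I. c i * \<xi> i \<omega>) \<partial>M) = char (distr M borel (\<lambda>\<omega>. \<Sum>i\<in>I. c i * \<xi> i \<omega>)) 1"
    by (simp add: char_def integral_distr)
  also have "\<dots> = (\<Prod>i\<in>I. char (distr M borel (\<lambda>\<omega>. c i * \<xi> i \<omega>)) 1)"
    by (intro char_distr_sum indep_vars_compose2[OF indep]) auto
  also have "\<dots> = complex_of_real (\<Prod>i\<in>I. exp (- (c i)\<^sup>2 / 2))"
    unfolding of_real_prod by (intro prod.cong refl factor)
  also have "(\<Prod>i\<in>I. exp (- (c i)\<^sup>2 / 2)) = exp (- (\<Sum>i\<in>I. (c i)\<^sup>2) / 2)"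
    by (cases "finite I") (simp_all add: exp_sum[symmetric] sum_negf sum_divide_distrib)
  finally show ?thesis .
qed

lemma (in prob_space) distr_sequence_std_normal:
  fixes \<xi> :: "nat \<Rightarrow> 'a \<Rightarrow> real"
  assumes "indep_vars (\<lambda>_. borel) \<xi> UNIV"
    and "\<And>k. distr M borel (\<xi> k) = std_normal_distribution"
  shows "distr M (\<Pi>\<^sub>M k\<in>UNIV. borel) (\<lambda>\<omega> k. \<xi> k \<omega>) = (\<Pi>\<^sub>M k\<in>UNIV. std_normal_distribution)"
  using indep_vars_iff_distr_eq_PiM'[where I = UNIV and M' = "\<lambda>_. borel" and X = \<xi>] assms
  by (simp add: indep_vars_def restrict_def)

lemma indep_vars_coordinates_std_normal:
  "prob_space.indep_vars (\<Pi>\<^sub>M k\<in>UNIV. std_normal_distribution) (\<lambda>_. borel) (\<lambda>(k::nat) a. a k) UNIV"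
  "distr (\<Pi>\<^sub>M k\<in>UNIV. std_normal_distribution) borel (\<lambda>a. a (k::nat)) = std_normal_distribution"
proof -
  interpret std: real_distribution std_normal_distribution by (rule real_dist_normal_dist)
  interpret N: product_prob_space "\<lambda>_::nat. std_normal_distribution" UNIV
    by (simp add: product_prob_space_def product_prob_space_axioms_def product_sigma_finite_def
        std.prob_space_axioms std.sigma_finite_measure_axioms)
  have coord: "distr (\<Pi>\<^sub>M k\<in>UNIV. std_normal_distribution) borel (\<lambda>a. a k) = std_normal_distribution"
    for k :: nat
  proof -
    have "distr (\<Pi>\<^sub>M k\<in>UNIV. std_normal_distribution) borel (\<lambda>a. a k)
        = distr (\<Pi>\<^sub>M k\<in>UNIV. std_normal_distribution) std_normal_distribution (\<lambda>a. a k)"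
      by (intro distr_cong) auto
    then show ?thesis using N.PiM_component[of k] by simp
  qed
  then show "distr (\<Pi>\<^sub>M k\<in>UNIV. std_normal_distribution) borel (\<lambda>a. a (k::nat)) = std_normal_distribution" .
  have sets: "sets (\<Pi>\<^sub>M k\<in>(UNIV::nat set). std_normal_distribution) = sets (\<Pi>\<^sub>M k\<in>UNIV. borel)"
    by (intro sets_PiM_cong) auto
  have "distr (\<Pi>\<^sub>M k\<in>(UNIV::nat set). std_normal_distribution) (\<Pi>\<^sub>M k\<in>UNIV. borel) (\<lambda>x. x)
      = (\<Pi>\<^sub>M k\<in>UNIV. std_normal_distribution)"
    by (rule distr_id2) (rule sets[symmetric])
  then show "N.indep_vars (\<lambda>_. borel) (\<lambda>(k::nat) a. a k) UNIV"
    by (subst N.indep_vars_iff_distr_eq_PiM') (auto simp: coord restrict_def)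
qed

context orthonormal_functionals
begin

lemma distr_e: "distr \<gamma> borel (blinfun_apply (e k)) = std_normal_distribution"
  using orthonormal[of k k] by (intro distr_functional_standard) (simp add: power2_eq_square)

text \<open>
  Both laws are centered Gaussian, with variance \<open>(\<Sum>k<n. (g (h k))\<^sup>2)\<close> in direction \<open>g\<close>.
\<close>
lemma distr_partial_sum:
  fixes \<xi> :: "nat \<Rightarrow> 'w \<Rightarrow> real"
  assumes "prob_space M" "prob_space.indep_vars M (\<lambda>_. borel) \<xi> UNIV"
    and std: "\<And>k. distr M borel (\<xi> k) = std_normal_distribution"
  shows "distr M borel (\<lambda>\<omega>. \<Sum>k<n. \<xi> k \<omega> *\<^sub>R h k) = distr \<gamma> borel (blinfun_apply (block 0 n))"
proof (rule measure_eqI_char_functional)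
  interpret M: prob_space M by fact
  have [measurable]: "\<xi> k \<in> borel_measurable M" for k
    using assms(2) unfolding M.indep_vars_def by auto
  show "prob_space (distr M borel (\<lambda>\<omega>. \<Sum>k<n. \<xi> k \<omega> *\<^sub>R h k))"
    "prob_space (distr \<gamma> borel (blinfun_apply (block 0 n)))"
    by (auto intro!: prob_space_distr M.prob_space_distr)
  fix g :: "'a \<Rightarrow>\<^sub>L real"
  have "(\<integral>v. iexp (blinfun_apply g v) \<partial>distr M borel (\<lambda>\<omega>. \<Sum>k<n. \<xi> k \<omega> *\<^sub>R h k))
      = (\<integral>\<omega>. iexp (\<Sum>k<n. blinfun_apply g (h k) * \<xi> k \<omega>) \<partial>M)"
    by (subst integral_distr) (auto simp: blinfun.sum_right blinfun.scaleR_right mult.commute)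
  also have "\<dots> = complex_of_real (exp (- (\<Sum>k<n. (blinfun_apply g (h k))\<^sup>2) / 2))"
    by (intro M.char_std_normal_combination M.indep_vars_subset[OF assms(2)] std) auto
  also have "\<dots> = (\<integral>v. iexp (blinfun_apply (g o\<^sub>L block 0 n) v) \<partial>\<gamma>)"
    unfolding char_functional by (simp add: integral_block_square lessThan_atLeast0)
  also have "\<dots> = (\<integral>v. iexp (blinfun_apply g v) \<partial>distr \<gamma> borel (blinfun_apply (block 0 n)))"
    by (subst integral_distr) auto
  finally show "(\<integral>v. iexp (blinfun_apply g v) \<partial>distr M borel (\<lambda>\<omega>. \<Sum>k<n. \<xi> k \<omega> *\<^sub>R h k))
      = (\<integral>v. iexp (blinfun_apply g v) \<partial>distr \<gamma> borel (blinfun_apply (block 0 n)))" .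
qed auto

text \<open>
  By biorthogonality \<open>e j\<close>, for \<open>j < n\<close>, reads off the \<open>j\<close>-th coefficient of a combination of
  \<open>h 0\<close>, ..., \<open>h (n - 1)\<close>. Finitely many coordinates therefore have the same joint law under \<open>\<gamma>\<close> as the
  coefficients of a partial sum with independent standard normal coefficients. The latter are realised
  as the coordinates on an infinite product space.
\<close>
theorem indep_vars_e: "indep_vars (\<lambda>_. borel) (\<lambda>k. blinfun_apply (e k)) UNIV"
proof -
  let ?N = "\<Pi>\<^sub>M k\<in>(UNIV::nat set). std_normal_distribution"
  interpret std: real_distribution std_normal_distribution by (rule real_dist_normal_dist)
  interpret N: product_prob_space "\<lambda>_::nat. std_normal_distribution" UNIV
    by (simp add: product_prob_space_def product_prob_space_axioms_def product_sigma_finite_def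
        std.prob_space_axioms std.sigma_finite_measure_axioms)
  have joint: "prob {v. \<forall>j\<in>J. blinfun_apply (e j) v \<in> A j}
      = (\<Prod>j\<in>J. prob {v. blinfun_apply (e j) v \<in> A j})"
    if J: "finite J" and A: "\<And>j. j \<in> J \<Longrightarrow> A j \<in> sets borel" for J A
  proof -
    obtain n where n: "J \<subseteq> {..<n}" using finite_nat_iff_bounded J by blast
    define C where "C = {v. \<forall>j\<in>J. blinfun_apply (e j) v \<in> A j}"
    have C: "C \<in> sets borel"
    proof -
      have "{v \<in> space borel. \<forall>j\<in>J. blinfun_apply (e j) v \<in> A j} \<in> sets borel"
      proof (rule sets.sets_Collect_finite_All[OF _ J])
        fix j assume "j \<in> J"
        have "blinfun_apply (e j) \<in> borel_measurable borel" by measurable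
        from measurable_sets[OF this A[OF \<open>j \<in> J\<close>]]
        show "{v \<in> space borel. blinfun_apply (e j) v \<in> A j} \<in> sets borel"
          by (simp add: vimage_def)
      qed
      then show ?thesis by (simp add: C_def)
    qed
    have m: "(\<lambda>a. \<Sum>k<n. a k *\<^sub>R h k) \<in> borel_measurable ?N" by measurable
    have e_sum: "blinfun_apply (e j) (\<Sum>k<n. a k *\<^sub>R h k) = a j" if "j \<in> J" for a j
      using n that by (auto simp: blinfun.sum_right blinfun.scaleR_right biorthogonal if_distrib
          cong: if_cong)
    have "prob C = measure (distr \<gamma> borel (blinfun_apply (block 0 n))) C"
    proof -
      have "blinfun_apply (block 0 n) -` C \<inter> space \<gamma> = C"
        using n by (auto simp: C_def functional_block)
      then show ?thesis using C by (subst measure_distr) auto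
    qed
    also have "\<dots> = measure (distr ?N borel (\<lambda>a. \<Sum>k<n. a k *\<^sub>R h k)) C"
      by (subst distr_partial_sum[OF N.prob_space_axioms])
        (auto intro!: indep_vars_coordinates_std_normal)
    also have "\<dots> = measure ?N {a \<in> space ?N. \<forall>j\<in>J. a j \<in> A j}"
      using C m by (subst measure_distr) (auto simp: C_def e_sum intro!: arg_cong[where f = "measure ?N"])
    also have "\<dots> = (\<Prod>j\<in>J. measure std_normal_distribution (A j))"
      using N.emeasure_PiM_Collect[of J A] J A
      by (simp add: N.emeasure_eq_measure std.emeasure_eq_measure prod_ennreal prod_nonneg)
    also have "\<dots> = (\<Prod>j\<in>J. prob {v. blinfun_apply (e j) v \<in> A j})"
      by (intro prod.cong refl, subst distr_e[symmetric], subst measure_distr)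
        (auto simp: A vimage_def)
    finally show ?thesis by (simp add: C_def)
  qed
  have pre: "blinfun_apply (e k) -` A \<in> events" if "A \<in> sets borel" for k A
  proof -
    have "blinfun_apply (e k) \<in> borel_measurable \<gamma>" by measurable
    from measurable_sets[OF this that] show ?thesis by simp
  qed
  show ?thesis
    unfolding indep_vars_def2
  proof (intro conjI ballI indep_setsI)
    fix A J assume J: "J \<noteq> {}" "J \<subseteq> UNIV" "finite J"
      and "\<forall>j\<in>J. A j \<in> {blinfun_apply (e j) -` B \<inter> space \<gamma> | B. B \<in> sets borel}"
    then have "\<forall>j\<in>J. \<exists>B. B \<in> sets borel \<and> A j = {v. blinfun_apply (e j) v \<in> B}"
      by (auto simp: vimage_def)
    then obtain B where B: "\<And>j. j \<in> J \<Longrightarrow> B j \<in> sets borel"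
      "\<And>j. j \<in> J \<Longrightarrow> A j = {v. blinfun_apply (e j) v \<in> B j}" by metis
    have "(\<Inter>j\<in>J. A j) = {v. \<forall>j\<in>J. blinfun_apply (e j) v \<in> B j}" using B(2) by auto
    then show "prob (\<Inter>j\<in>J. A j) = (\<Prod>j\<in>J. prob (A j))"
      using joint[OF J(3), of B] B by simp
  qed (auto simp: pre)
qed

end

context functional_basis
begin

text \<open>
  The sequences \<open>\<xi>\<close> under \<open>M\<close> and \<open>e\<close> under \<open>\<gamma>\<close> have the same law on the sequence space. Both
  summability and the value of the sum are measurable there, so everything is inherited from the
  expansion of \<open>v\<close> under \<open>\<gamma>\<close>.
\<close>
theorem random_series_law:
  fixes M :: "'w measure" and \<xi> :: "nat \<Rightarrow> 'w \<Rightarrow> real"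
  assumes "prob_space M" "prob_space.indep_vars M (\<lambda>_. borel) \<xi> UNIV"
    and std: "\<And>k. distr M borel (\<xi> k) = std_normal_distribution"
  shows "AE \<omega> in M. summable (\<lambda>k. \<xi> k \<omega> *\<^sub>R h k)"
    and "(\<lambda>\<omega>. \<Sum>k. \<xi> k \<omega> *\<^sub>R h k) \<in> borel_measurable M"
    and "distr M borel (\<lambda>\<omega>. \<Sum>k. \<xi> k \<omega> *\<^sub>R h k) = \<gamma>"
proof -
  interpret M: prob_space M by fact
  have \<xi> [measurable]: "\<xi> k \<in> borel_measurable M" for k
    using assms(2) unfolding M.indep_vars_def by auto
  show S\<xi>: "(\<lambda>\<omega>. \<Sum>k. \<xi> k \<omega> *\<^sub>R h k) \<in> borel_measurable M" by measurable
  let ?R = "\<Pi>\<^sub>M k\<in>(UNIV::nat set). (borel :: real measure)"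
  have law: "distr M ?R (\<lambda>\<omega> k. \<xi> k \<omega>) = distr \<gamma> ?R (\<lambda>v k. blinfun_apply (e k) v)"
    using M.distr_sequence_std_normal[OF assms(2) std]
      distr_sequence_std_normal[OF indep_vars_e distr_e] by simp
  have m: "(\<lambda>\<omega> k. \<xi> k \<omega>) \<in> M \<rightarrow>\<^sub>M ?R" "(\<lambda>v k. blinfun_apply (e k) v) \<in> \<gamma> \<rightarrow>\<^sub>M ?R"
    by (auto intro!: measurable_PiM_single' simp: space_PiM)
  have P: "{a \<in> space ?R. summable (\<lambda>k. a k *\<^sub>R h k)} \<in> sets ?R"
    unfolding summable_iff_convergent Cauchy_convergent_iff[symmetric] by measurable
  have S: "(\<lambda>a. \<Sum>k. a k *\<^sub>R h k) \<in> borel_measurable ?R" by measurable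
  have "AE a in distr \<gamma> ?R (\<lambda>v k. blinfun_apply (e k) v). summable (\<lambda>k. a k *\<^sub>R h k)"
    unfolding AE_distr_iff[OF m(2) P] using AE_sums by eventually_elim (rule sums_summable)
  then show "AE \<omega> in M. summable (\<lambda>k. \<xi> k \<omega> *\<^sub>R h k)"
    unfolding law[symmetric] AE_distr_iff[OF m(1) P] .
  have "distr M borel (\<lambda>\<omega>. \<Sum>k. \<xi> k \<omega> *\<^sub>R h k)
      = distr (distr M ?R (\<lambda>\<omega> k. \<xi> k \<omega>)) borel (\<lambda>a. \<Sum>k. a k *\<^sub>R h k)"
    by (subst distr_distr[OF S m(1)]) (simp add: comp_def)
  also have "\<dots> = distr \<gamma> borel (\<lambda>v. \<Sum>k. blinfun_apply (e k) v *\<^sub>R h k)"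
    unfolding law by (subst distr_distr[OF S m(2)]) (simp add: comp_def)
  also have "\<dots> = distr \<gamma> borel (\<lambda>v. v)"
    using AE_sums by (intro distr_cong_AE) (auto elim!: AE_mp simp: sums_iff)
  also have "\<dots> = \<gamma>" by (rule distr_id2) (rule sets_eq_borel[symmetric])
  finally show "distr M borel (\<lambda>\<omega>. \<Sum>k. \<xi> k \<omega> *\<^sub>R h k) = \<gamma>" .
qed

end

section \<open>The iterative decomposition\<close>

lemma eq_if_functionals_eq:
  fixes u w :: "'a::real_normed_vector"
  assumes "\<And>g :: 'a \<Rightarrow>\<^sub>L real. blinfun_apply g u = blinfun_apply g w"
  shows "u = w"
proof -
  obtain g :: "'a \<Rightarrow>\<^sub>L real" where "blinfun_apply g (u - w) = norm (u - w)"
    using norming_functional_exists by blast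
  then show ?thesis using assms[of g] by (simp add: blinfun.diff_right)
qed

text \<open>
  The recursive definition of the projections collapses to a finite rank operator with the functionals
  \<open>decomp_x_dual f x k\<close> as coordinates.
\<close>
lemma decomp_proj_eq_sum:
  "blinfun_apply (decomp_proj f x n) v = (\<Sum>k<n. blinfun_apply (decomp_x_dual f x k) v *\<^sub>R x k)"
proof (cases n)
  case (Suc m)
  show ?thesis
    unfolding Suc decomp_proj_Suc_apply lessThan_Suc_atMost
    by (simp add: decomp_x_dual_def blinfun.diff_left)
qed simp

text \<open>
  Sequential weak-star compactness of the dual unit ball: a diagonal sequence converges on a countable
  dense set, and equicontinuity extends the convergence to all vectors.
\<close>
lemma functional_sequence_pointwise_convergent_subsequence:
  fixes f :: "nat \<Rightarrow> 'a::{real_normed_vector,second_countable_topology} \<Rightarrow>\<^sub>L real"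
  assumes "\<And>n. norm (f n) \<le> 1"
  obtains s where "strict_mono s" "\<And>v. convergent (\<lambda>i. blinfun_apply (f (s i)) v)"
proof -
  have le: "\<bar>blinfun_apply (f n) v\<bar> \<le> norm v" for n v
    using norm_blinfun[of "f n" v] mult_right_mono[OF assms[of n] norm_ge_zero[of v]] by simp
  obtain D :: "'a set" where D: "countable D" "\<And>U. open U \<Longrightarrow> U \<noteq> {} \<Longrightarrow> \<exists>d\<in>D. d \<in> U"
    using countable_dense_exists by blast
  have "D \<noteq> {}" using D(2)[OF open_UNIV] by auto
  define d where "d = from_nat_into D"
  interpret subseqs "\<lambda>k s. convergent (\<lambda>i. blinfun_apply (f (s i)) (d k))"
  proof
    fix k and s :: "nat \<Rightarrow> nat"
    have "bounded (range (\<lambda>i. blinfun_apply (f (s i)) (d k)))"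
      unfolding bounded_iff using le by auto
    then obtain l r where "strict_mono r" "((\<lambda>i. blinfun_apply (f (s i)) (d k)) \<circ> r) \<longlonglongrightarrow> l"
      using bounded_imp_convergent_subsequence by blast
    then show "\<exists>r. strict_mono r \<and> convergent (\<lambda>i. blinfun_apply (f ((s \<circ> r) i)) (d k))"
      by (auto simp: convergent_def comp_def)
  qed
  define s where "s = diagseq"
  have s: "strict_mono s" unfolding s_def by (rule subseq_diagseq)
  have conv: "convergent (\<lambda>i. blinfun_apply (f (s i)) (d k))" for k
  proof -
    have "convergent (\<lambda>i. blinfun_apply (f ((diagseq \<circ> (+) (Suc k)) i)) (d k))"
    proof (rule diagseq_holds)
      fix r t :: "nat \<Rightarrow> nat" and n
      assume "strict_mono r" "convergent (\<lambda>i. blinfun_apply (f (t i)) (d n))"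
      then show "convergent (\<lambda>i. blinfun_apply (f ((t \<circ> r) i)) (d n))"
        using convergent_subseq_convergent[of "\<lambda>i. blinfun_apply (f (t i)) (d n)" r]
        by (simp add: comp_def)
    qed
    then have "convergent (\<lambda>i. blinfun_apply (f (s (i + Suc k))) (d k))"
      by (simp add: s_def comp_def add.commute)
    then show ?thesis unfolding convergent_ignore_initial_segment[where f = "\<lambda>i. blinfun_apply (f (s i)) (d k)"] .
  qed
  have "Cauchy (\<lambda>i. blinfun_apply (f (s i)) v)" for v
  proof (rule CauchyI)
    fix r :: real assume r: "0 < r"
    obtain u where "u \<in> D" "norm (v - u) < r / 3"
      using D(2)[of "ball v (r / 3)"] r by (auto simp: dist_norm)
    then obtain k where k: "norm (v - d k) < r / 3"
      using from_nat_into_surj[OF D(1)] unfolding d_def by metis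
    have "Cauchy (\<lambda>i. blinfun_apply (f (s i)) (d k))"
      using conv by (simp add: Cauchy_convergent_iff)
    from CauchyD[OF this, of "r / 3"] r obtain M where M: "\<And>m n. m \<ge> M \<Longrightarrow> n \<ge> M \<Longrightarrow>
        norm (blinfun_apply (f (s m)) (d k) - blinfun_apply (f (s n)) (d k)) < r / 3" by auto
    have "norm (blinfun_apply (f (s m)) v - blinfun_apply (f (s n)) v) < r" if "m \<ge> M" "n \<ge> M" for m n
    proof -
      have "blinfun_apply (f (s m)) v - blinfun_apply (f (s n)) v
          = blinfun_apply (f (s m)) (v - d k) - blinfun_apply (f (s n)) (v - d k)
            + (blinfun_apply (f (s m)) (d k) - blinfun_apply (f (s n)) (d k))"
        by (simp add: blinfun.diff_right)
      then show ?thesis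
        using M[OF that] le[of "s m" "v - d k"] le[of "s n" "v - d k"] k unfolding real_norm_def by linarith
    qed
    then show "\<exists>M. \<forall>m\<ge>M. \<forall>n\<ge>M.
        norm (blinfun_apply (f (s m)) v - blinfun_apply (f (s n)) v) < r" by blast
  qed
  then show thesis using that s by (simp add: Cauchy_convergent_iff)
qed

text \<open>
  Along a pointwise convergent subsequence consecutive differences tend to zero in \<open>L^2(\<gamma>)\<close>, by
  dominated convergence with majorant \<open>4 * (norm v)\<^sup>2\<close>.
\<close>
lemma (in centered_gaussian) L2_precompact_functionals:
  fixes f :: "nat \<Rightarrow> 'a \<Rightarrow>\<^sub>L real"
  assumes f: "\<And>n. norm (f n) \<le> 1"
    and r: "r > 0"
  shows "\<exists>m n. m < n \<and> (\<integral>v. (blinfun_apply (f n - f m) v)\<^sup>2 \<partial>\<gamma>) < r"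
proof -
  have le: "\<bar>blinfun_apply (f n) v\<bar> \<le> norm v" for n v
    using functional_bound[of "f n" v] mult_right_mono[OF f[of n] norm_ge_zero[of v]] by simp
  obtain s where s: "strict_mono s" "\<And>v. convergent (\<lambda>i. blinfun_apply (f (s i)) v)"
    using functional_sequence_pointwise_convergent_subsequence[of f] f by metis
  let ?d = "\<lambda>i v. (blinfun_apply (f (s (Suc i)) - f (s i)) v)\<^sup>2"
  have "(\<lambda>i. \<integral>v. ?d i v \<partial>\<gamma>) \<longlonglongrightarrow> (\<integral>v. 0 \<partial>\<gamma>)"
  proof (rule integral_dominated_convergence[where w = "\<lambda>v. 4 * (norm v)\<^sup>2"])
    show "integrable \<gamma> (\<lambda>v. 4 * (norm v)\<^sup>2)" using integrable_norm_square by simp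
    show "AE v in \<gamma>. (\<lambda>i. ?d i v) \<longlonglongrightarrow> 0"
    proof (rule AE_I2)
      fix v
      obtain l where l: "(\<lambda>i. blinfun_apply (f (s i)) v) \<longlonglongrightarrow> l"
        using s(2) unfolding convergent_def by blast
      have "(\<lambda>i. (blinfun_apply (f (s (Suc i))) v - blinfun_apply (f (s i)) v)\<^sup>2) \<longlonglongrightarrow> (l - l)\<^sup>2"
        by (intro tendsto_intros l LIMSEQ_Suc)
      then show "(\<lambda>i. ?d i v) \<longlonglongrightarrow> 0" by (simp add: blinfun.diff_left)
    qed
    show "AE v in \<gamma>. norm (?d i v) \<le> 4 * (norm v)\<^sup>2" for i
    proof (rule AE_I2)
      fix v
      have "\<bar>blinfun_apply (f (s (Suc i)) - f (s i)) v\<bar> \<le> 2 * norm v"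
        using le[of "s (Suc i)" v] le[of "s i" v] by (simp add: blinfun.diff_left)
      then have "\<bar>blinfun_apply (f (s (Suc i)) - f (s i)) v\<bar>\<^sup>2 \<le> (2 * norm v)\<^sup>2"
        by (intro power_mono) auto
      then show "norm (?d i v) \<le> 4 * (norm v)\<^sup>2" by (simp add: power_mult_distrib)
    qed
  qed auto
  then have "\<forall>\<^sub>F i in sequentially. (\<integral>v. ?d i v \<partial>\<gamma>) < r" using r by (intro order_tendstoD) auto
  then obtain i where "(\<integral>v. ?d i v \<partial>\<gamma>) < r" by (meson eventually_sequentially order_refl)
  moreover have "s i < s (Suc i)" using s(1) by (simp add: strict_mono_Suc_iff)
  ultimately show ?thesis by blast
qed

locale gaussian_decomposition = centered_gaussian \<gamma>
  for \<gamma> :: "'a::{banach,second_countable_topology} measure" +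
  fixes G :: "nat \<Rightarrow> 'a measure" and lam :: "nat \<Rightarrow> real"
    and f :: "nat \<Rightarrow> 'a \<Rightarrow>\<^sub>L real" and x :: "nat \<Rightarrow> 'a"
  assumes decomposition: "iterative_decomposition \<gamma> G lam f x"
begin

abbreviation xd :: "nat \<Rightarrow> 'a \<Rightarrow>\<^sub>L real" where "xd \<equiv> decomp_x_dual f x"

definition residual :: "nat \<Rightarrow> 'a \<Rightarrow>\<^sub>L 'a" where
  "residual n = id_blinfun - decomp_proj f x n"

lemma residual_apply: "blinfun_apply (residual n) v = v - (\<Sum>k<n. blinfun_apply (xd k) v *\<^sub>R x k)"
  by (simp add: residual_def blinfun.diff_left decomp_proj_eq_sum)

lemma xd_apply: "blinfun_apply (xd n) v = blinfun_apply (f n) (blinfun_apply (residual n) v)"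
  by (simp add: decomp_x_dual_def residual_def)

lemma residual_Suc:
  "blinfun_apply (residual (Suc n)) v = blinfun_apply (residual n) v - blinfun_apply (xd n) v *\<^sub>R x n"
  by (simp add: residual_apply)

lemma functional_residual_Suc:
  fixes g :: "'a \<Rightarrow>\<^sub>L real"
  shows "blinfun_apply g (blinfun_apply (residual (Suc n)) v)
    = blinfun_apply g (blinfun_apply (residual n) v) - blinfun_apply (xd n) v * blinfun_apply g (x n)"
  by (simp add: residual_Suc blinfun.diff_right blinfun.scaleR_right)

lemma G_eq_distr: "G n = distr \<gamma> borel (blinfun_apply (residual n))"
proof (induction n)
  case 0
  have "blinfun_apply (residual 0) = (\<lambda>v. v)" by (simp add: residual_apply fun_eq_iff)
  then have "distr \<gamma> borel (blinfun_apply (residual 0)) = \<gamma>"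
    by (simp only:) (rule distr_id2, rule sets_eq_borel[symmetric])
  then show ?case using decomposition by (simp add: iterative_decomposition_def)
next
  case (Suc n)
  have m: "(\<lambda>v. v - blinfun_apply (f n) v *\<^sub>R x n) \<in> borel \<rightarrow>\<^sub>M borel" by measurable
  have r: "blinfun_apply (residual n) \<in> \<gamma> \<rightarrow>\<^sub>M borel" by measurable
  have "G (Suc n) = distr (G n) borel (\<lambda>v. v - blinfun_apply (f n) v *\<^sub>R x n)"
    using decomposition by (simp add: iterative_decomposition_def)
  also have "\<dots> = distr \<gamma> borel (blinfun_apply (residual (Suc n)))"
  proof -
    have "blinfun_apply (residual (Suc n)) = (\<lambda>v. v - blinfun_apply (f n) v *\<^sub>R x n) \<circ> blinfun_apply (residual n)"
      by (simp add: fun_eq_iff residual_Suc xd_apply)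
    then show ?thesis unfolding Suc distr_distr[OF m r] by simp
  qed
  finally show ?case .
qed

lemma functional_cov_op_G:
  fixes g g' :: "'a \<Rightarrow>\<^sub>L real"
  shows "blinfun_apply g' (cov_op (G n) g)
    = (\<integral>v. blinfun_apply g (blinfun_apply (residual n) v) * blinfun_apply g' (blinfun_apply (residual n) v) \<partial>\<gamma>)"
proof -
  have "cov_op (G n) g = (\<integral>v. blinfun_apply (g o\<^sub>L residual n) v *\<^sub>R blinfun_apply (residual n) v \<partial>\<gamma>)"
    unfolding cov_op_def G_eq_distr by (subst integral_distr) auto
  then show ?thesis
    using blinfun_cov_op[of "residual n" "g o\<^sub>L residual n"]
      functional_cov_op[of "g' o\<^sub>L residual n" "g o\<^sub>L residual n"] by simp
qed

text \<open>
  Maximality of \<open>f n\<close> in the dual unit ball, extended to all functionals by homogeneity.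
\<close>
lemma residual_variance_le:
  fixes g :: "'a \<Rightarrow>\<^sub>L real"
  shows "(\<integral>v. (blinfun_apply g (blinfun_apply (residual n) v))\<^sup>2 \<partial>\<gamma>) \<le> lam n * (norm g)\<^sup>2"
proof (cases "g = 0")
  case False
  let ?g = "(1 / norm g) *\<^sub>R g"
  have "norm ?g \<le> 1" using False by simp
  then have "blinfun_apply ?g (cov_op (G n) ?g) \<le> lam n"
    using decomposition unfolding iterative_decomposition_def by blast
  then have "(\<integral>v. (blinfun_apply g (blinfun_apply (residual n) v))\<^sup>2 / (norm g)\<^sup>2 \<partial>\<gamma>) \<le> lam n"
    by (simp add: functional_cov_op_G blinfun.scaleR_left power2_eq_square)
  then show ?thesis using False by (simp add: pos_divide_le_eq)
qed simp

lemma norm_f: "norm (f n) = 1"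
  using decomposition by (simp add: iterative_decomposition_def)

lemma integral_xd_residual:
  fixes g :: "'a \<Rightarrow>\<^sub>L real"
  shows "(\<integral>v. blinfun_apply (xd n) v * blinfun_apply g (blinfun_apply (residual n) v) \<partial>\<gamma>)
    = lam n * blinfun_apply g (x n)"
proof -
  have "cov_op (G n) (f n) = lam n *\<^sub>R x n"
    using decomposition by (simp add: iterative_decomposition_def)
  then show ?thesis
    using functional_cov_op_G[of g n "f n"] by (simp add: xd_apply blinfun.scaleR_right)
qed

lemma integral_xd_square: "(\<integral>v. blinfun_apply (xd n) v * blinfun_apply (xd n) v \<partial>\<gamma>) = lam n"
proof -
  have "blinfun_apply (f n) (cov_op (G n) (f n)) = lam n"
    using decomposition unfolding iterative_decomposition_def by blast
  then show ?thesis by (simp add: functional_cov_op_G xd_apply)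
qed

text \<open>
  The step from residual \<open>m\<close> to residual \<open>Suc m\<close> subtracts a multiple of \<open>x_m^*\<close>. For \<open>m = n\<close> the
  correlation with \<open>x_n^*\<close> becomes zero because \<open>x n\<close> is the regression coefficient; for \<open>m > n\<close> it
  stays zero because \<open>x_m^*\<close> is itself a functional of the \<open>m\<close>-th residual.
\<close>
lemma integral_xd_later_residual:
  fixes g :: "'a \<Rightarrow>\<^sub>L real"
  assumes "n < m"
  shows "(\<integral>v. blinfun_apply (xd n) v * blinfun_apply g (blinfun_apply (residual m) v) \<partial>\<gamma>) = 0"
proof -
  have int: "integrable \<gamma> (\<lambda>v. blinfun_apply (xd n) v * blinfun_apply g (blinfun_apply (residual m) v))"
    for m and g :: "'a \<Rightarrow>\<^sub>L real"
    using integrable_functional_mult[of "xd n" "g o\<^sub>L residual m"] by simp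
  have rec: "(\<integral>v. blinfun_apply (xd n) v * blinfun_apply g (blinfun_apply (residual (Suc m)) v) \<partial>\<gamma>)
      = (\<integral>v. blinfun_apply (xd n) v * blinfun_apply g (blinfun_apply (residual m) v) \<partial>\<gamma>)
        - (\<integral>v. blinfun_apply (xd n) v * blinfun_apply (xd m) v \<partial>\<gamma>) * blinfun_apply g (x m)"
    for m and g :: "'a \<Rightarrow>\<^sub>L real"
  proof -
    have "(\<integral>v. blinfun_apply (xd n) v * blinfun_apply g (blinfun_apply (residual (Suc m)) v) \<partial>\<gamma>)
      = (\<integral>v. blinfun_apply (xd n) v * blinfun_apply g (blinfun_apply (residual m) v)
          - (blinfun_apply (xd n) v * blinfun_apply (xd m) v) * blinfun_apply g (x m) \<partial>\<gamma>)"
      by (simp add: functional_residual_Suc algebra_simps)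
    then show ?thesis using int integrable_functional_mult by simp
  qed
  have "Suc n \<le> m" using assms by simp
  then show ?thesis
  proof (induction m arbitrary: g rule: dec_induct)
    case base
    show ?case by (simp add: rec integral_xd_residual integral_xd_square)
  next
    case (step m)
    have "(\<integral>v. blinfun_apply (xd n) v * blinfun_apply (xd m) v \<partial>\<gamma>) = 0"
      using step.IH[of "f m"] by (simp add: xd_apply)
    then show ?case by (simp add: rec step.IH)
  qed
qed

lemma xd_orthogonal:
  "(\<integral>v. blinfun_apply (xd n) v * blinfun_apply (xd m) v \<partial>\<gamma>) = (if n = m then lam n else 0)"
proof -
  have lt: "(\<integral>v. blinfun_apply (xd n) v * blinfun_apply (xd m) v \<partial>\<gamma>) = 0" if "n < m" for n m
    using integral_xd_later_residual[OF that, of "f m"] by (simp add: xd_apply)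
  show ?thesis
    using lt[of n m] lt[of m n] by (cases n m rule: linorder_cases) (auto simp: integral_xd_square mult.commute)
qed

lemma integral_xd_functional:
  fixes g :: "'a \<Rightarrow>\<^sub>L real"
  shows "(\<integral>v. blinfun_apply (xd n) v * blinfun_apply g v \<partial>\<gamma>) = lam n * blinfun_apply g (x n)"
proof -
  have "blinfun_apply (xd n) v * blinfun_apply g v
      = blinfun_apply (xd n) v * blinfun_apply g (blinfun_apply (residual n) v)
        + (\<Sum>k<n. (blinfun_apply (xd n) v * blinfun_apply (xd k) v) * blinfun_apply g (x k))" for v
    by (simp add: residual_apply blinfun.diff_right blinfun.sum_right blinfun.scaleR_right
        right_diff_distrib sum_distrib_left mult_ac)
  moreover have "integrable \<gamma> (\<lambda>v. blinfun_apply (xd n) v * blinfun_apply g (blinfun_apply (residual n) v))"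
    using integrable_functional_mult[of "xd n" "g o\<^sub>L residual n"] by simp
  ultimately show ?thesis
    by (simp add: integrable_functional_mult integral_xd_residual xd_orthogonal)
qed

text \<open>
  As \<open>f m\<close> is a linear combination of \<open>x_0^*\<close>, ..., \<open>x_m^*\<close>, it is orthogonal in \<open>L^2(\<gamma>)\<close> to
  \<open>x_n^*\<close>, whereas the product of \<open>f n\<close> and \<open>x_n^*\<close> is \<open>lam n\<close>. Hence \<open>x_n^*\<close>, of squared norm
  \<open>lam n\<close>, is the orthogonal projection of \<open>f n - f m\<close> onto its own span.
\<close>
lemma lam_le_distance:
  assumes "m < n"
  shows "lam n \<le> (\<integral>v. (blinfun_apply (f n - f m) v)\<^sup>2 \<partial>\<gamma>)"
proof -
  have n: "lam n * blinfun_apply (f n) (x n) = lam n"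
    using integral_xd_residual[of n "f n"] integral_xd_square[of n] by (simp add: xd_apply)
  have "blinfun_apply (xd n) v * blinfun_apply (f m) v = blinfun_apply (xd n) v * blinfun_apply (xd m) v
        + (\<Sum>k<m. (blinfun_apply (xd n) v * blinfun_apply (xd k) v) * blinfun_apply (f m) (x k))" for v
    unfolding xd_apply[of m]
    by (simp add: residual_apply[of m] blinfun.diff_right blinfun.sum_right blinfun.scaleR_right
        right_diff_distrib sum_distrib_left mult_ac)
  then have m: "(\<integral>v. blinfun_apply (xd n) v * blinfun_apply (f m) v \<partial>\<gamma>) = 0"
    using assms by (simp add: integrable_functional_mult xd_orthogonal)
  let ?g = "f n - f m"
  have g: "(\<integral>v. blinfun_apply (xd n) v * blinfun_apply ?g v \<partial>\<gamma>) = lam n"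
    using n m integral_xd_functional[of n "f n"]
    by (simp add: blinfun.diff_left right_diff_distrib integrable_functional_mult)
  have "0 \<le> (\<integral>v. (blinfun_apply ?g v - blinfun_apply (xd n) v)\<^sup>2 \<partial>\<gamma>)" by simp
  also have "\<dots> = (\<integral>v. (blinfun_apply ?g v)\<^sup>2 - 2 * (blinfun_apply (xd n) v * blinfun_apply ?g v)
      + blinfun_apply (xd n) v * blinfun_apply (xd n) v \<partial>\<gamma>)"
    by (intro Bochner_Integration.integral_cong refl) (simp add: power2_eq_square algebra_simps)
  also have "\<dots> = (\<integral>v. (blinfun_apply ?g v)\<^sup>2 \<partial>\<gamma>) - 2 * lam n + lam n"
    using integrable_functional_square[of ?g] integrable_functional_mult[of "xd n" ?g]
      integrable_functional_mult[of "xd n" "xd n"] g integral_xd_square[of n] by simp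
  finally show ?thesis by simp
qed

lemma lam_nonneg: "lam n \<ge> 0"
  unfolding integral_xd_square[of n, symmetric] by (rule Bochner_Integration.integral_nonneg) simp

text \<open>
  Otherwise infinitely many of the \<open>f n\<close> would be uniformly separated in \<open>L^2(\<gamma>)\<close>.
\<close>
lemma lam_tendsto_0: "lam \<longlonglongrightarrow> 0"
proof (rule LIMSEQ_I)
  fix r :: real assume r: "0 < r"
  show "\<exists>N. \<forall>n\<ge>N. norm (lam n - 0) < r"
  proof (rule ccontr)
    assume "\<not> (\<exists>N. \<forall>n\<ge>N. norm (lam n - 0) < r)"
    then have "\<forall>N. \<exists>n\<ge>N. \<not> norm (lam n - 0) < r" by blast
    then have unb: "\<forall>N. \<exists>n\<ge>N. lam n \<ge> r"
      using lam_nonneg by (simp add: not_less)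
    define S where "S = {n. lam n \<ge> r}"
    have "infinite S" unfolding infinite_nat_iff_unbounded_le using unb by (simp add: S_def)
    define s where "s = enumerate S"
    have s: "strict_mono s" "\<And>i. lam (s i) \<ge> r"
      using strict_mono_enumerate[OF \<open>infinite S\<close>] enumerate_in_set[OF \<open>infinite S\<close>]
      by (simp_all add: s_def S_def)
    obtain m n where mn: "m < n" "(\<integral>v. (blinfun_apply (f (s n) - f (s m)) v)\<^sup>2 \<partial>\<gamma>) < r"
      using L2_precompact_functionals[of "\<lambda>i. f (s i)" r] norm_f r by auto
    have "s m < s n" using s(1) mn(1) by (simp add: strict_mono_def)
    then show False using lam_le_distance[of "s m" "s n"] s(2)[of n] mn(2) by linarith
  qed
qed

text \<open>
  If \<open>lam n = 0\<close>, every functional of the \<open>n\<close>-th residual vanishes almost surely; applied to a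
  countable norming family this shows that the residual itself does.
  The residual map then annihilates \<open>cov_op \<gamma> g\<close> for all \<open>g\<close>, and by density and the
  continuous embedding all of \<open>H\<close>. So every \<open>u \<in> H\<close> is the combination of \<open>x 0\<close>, ..., \<open>x (n - 1)\<close>
  given by its first \<open>n\<close> coordinates, and \<open>H\<close> has finite dimension.
\<close>
lemma lam_pos:
  assumes cm: "cameron_martin_space \<gamma> H ip"
    and inf: "\<not> (\<exists>B. finite B \<and> span B = H)"
  shows "lam n > 0"
proof (rule ccontr)
  assume "\<not> lam n > 0"
  then have l0: "lam n = 0" using lam_nonneg[of n] by simp
  obtain g :: "nat \<Rightarrow> 'a \<Rightarrow>\<^sub>L real"
    where g: "\<And>v r. norm v \<le> r \<longleftrightarrow> (\<forall>k. blinfun_apply (g k) v \<le> r)"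
    using norming_sequence_exists by metis
  have "AE v in \<gamma>. blinfun_apply (g k) (blinfun_apply (residual n) v) = 0" for k
  proof -
    let ?q = "\<lambda>v. (blinfun_apply (g k) (blinfun_apply (residual n) v))\<^sup>2"
    have "(\<integral>v. ?q v \<partial>\<gamma>) \<le> 0" using residual_variance_le[of "g k" n] l0 by simp
    moreover have "0 \<le> (\<integral>v. ?q v \<partial>\<gamma>)" by (rule Bochner_Integration.integral_nonneg) simp
    ultimately have zero: "(\<integral>v. ?q v \<partial>\<gamma>) = 0" by linarith
    have int: "integrable \<gamma> ?q" using integrable_functional_square[of "g k o\<^sub>L residual n"] by simp
    have "AE v in \<gamma>. ?q v = 0"
      using integral_nonneg_eq_0_iff_AE[OF int] zero by simp
    then show ?thesis by simp
  qed
  then have "AE v in \<gamma>. \<forall>k. blinfun_apply (g k) (blinfun_apply (residual n) v) = 0"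
    by (simp add: AE_all_countable)
  then have res0: "AE v in \<gamma>. blinfun_apply (residual n) v = 0"
  proof eventually_elim
    case (elim v)
    then have "norm (blinfun_apply (residual n) v) \<le> 0" unfolding g by simp
    then show ?case by simp
  qed
  have cov0: "blinfun_apply (residual n) (cov_op \<gamma> g) = 0" for g :: "'a \<Rightarrow>\<^sub>L real"
  proof -
    have "AE v in \<gamma>. blinfun_apply g v *\<^sub>R blinfun_apply (residual n) v = 0"
      using res0 by eventually_elim simp
    then show ?thesis unfolding blinfun_cov_op by (rule integral_eq_zero_AE)
  qed
  have hil: "hilbertian_subspace H ip" and ran: "range (cov_op \<gamma>) \<subseteq> H"
    and dense: "\<And>u e. u \<in> H \<Longrightarrow> e > 0 \<Longrightarrow> \<exists>g. sqrt (ip (u - cov_op \<gamma> g) (u - cov_op \<gamma> g)) < e"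
    using cm by (simp_all add: cameron_martin_space_def)
  have H: "subspace H" and emb: "\<exists>C. \<forall>u\<in>H. norm u \<le> C * sqrt (ip u u)"
    and ip_scale: "\<And>c u v. u \<in> H \<Longrightarrow> v \<in> H \<Longrightarrow> ip (c *\<^sub>R u) v = c * ip u v"
    and ip_pos: "\<And>u. u \<in> H \<Longrightarrow> u \<noteq> 0 \<Longrightarrow> 0 < ip u u"
    using hil by (simp_all add: hilbertian_subspace_def)
  obtain C where C: "\<And>u. u \<in> H \<Longrightarrow> norm u \<le> C * sqrt (ip u u)" using emb by blast
  have "blinfun_apply (residual n) u = 0" if u: "u \<in> H" for u
  proof -
    have "norm (blinfun_apply (residual n) u) \<le> 0 + e" if e: "e > 0" for e
    proof -
      \<comment> \<open>Bound for the residual map composed with the embedding of \<open>H\<close>. The embedding constant \<open>C\<close> may be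
        negative and the residual map may vanish, whence \<open>max C 1\<close> and the summand \<open>1\<close>.\<close>
      define K where "K = norm (residual n) * max C 1 + 1"
      have K: "K > 0" by (simp add: K_def add_nonneg_pos mult_nonneg_nonneg max_def)
      obtain g where gd: "sqrt (ip (u - cov_op \<gamma> g) (u - cov_op \<gamma> g)) < e / K"
        using dense[OF u divide_pos_pos[OF e K]] by blast
      let ?w = "u - cov_op \<gamma> g"
      have w: "?w \<in> H" using H u ran by (intro subspace_diff) auto
      have s0: "sqrt (ip ?w ?w) \<ge> 0"
      proof (cases "?w = 0")
        case True
        have "ip (0 *\<^sub>R ?w) ?w = 0 * ip ?w ?w" using ip_scale w by blast
        then show ?thesis using True by simp
      next
        case False
        then show ?thesis using ip_pos[OF w] by simp
      qed
      have "norm (blinfun_apply (residual n) u) = norm (blinfun_apply (residual n) ?w)"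
        by (simp add: blinfun.diff_right cov0)
      also have "\<dots> \<le> norm (residual n) * norm ?w" by (rule norm_blinfun)
      also have "\<dots> \<le> norm (residual n) * (max C 1 * sqrt (ip ?w ?w))"
        using order_trans[OF C[OF w] mult_right_mono[OF max.cobounded1 s0]]
        by (intro mult_left_mono) simp_all
      also have "\<dots> \<le> K * sqrt (ip ?w ?w)"
        using s0 by (simp add: K_def algebra_simps)
      also have "\<dots> \<le> e" using gd K by (simp add: pos_less_divide_eq mult.commute)
      finally show ?thesis by simp
    qed
    then have "norm (blinfun_apply (residual n) u) \<le> 0" by (rule field_le_epsilon)
    then show ?thesis by simp
  qed
  then have sub: "H \<subseteq> span (x ` {..<n})"
  proof (intro subsetI)
    fix u assume "u \<in> H" "\<And>u. u \<in> H \<Longrightarrow> blinfun_apply (residual n) u = 0"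
    then have "u = (\<Sum>k<n. blinfun_apply (xd k) u *\<^sub>R x k)" using residual_apply[of n u] by simp
    also have "\<dots> \<in> span (x ` {..<n})" by (intro span_sum span_scale span_base) auto
    finally show "u \<in> span (x ` {..<n})" .
  qed
  obtain B where B: "B \<subseteq> H" "independent B" "H \<subseteq> span B" by (rule maximal_independent_subset)
  then have "finite B" using independent_span_bound[of "x ` {..<n}" B] sub by auto
  moreover have "span B = H" using B H by (simp add: span_minimal subset_antisym)
  ultimately show False using inf by blast
qed

text \<open>
  Orthonormality and \<open>h = decomp_h lam x\<close> are the orthogonality relations after normalisation by
  \<open>sqrt (lam n)\<close>. Parseval's identity holds since the missing part, the variance of the \<open>n\<close>-th
  residual, is at most \<open>lam n * (norm g)\<^sup>2\<close>.
\<close>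
lemma functional_basis_decomp:
  assumes pos: "\<And>n. lam n > 0"
  shows "functional_basis \<gamma> (decomp_h_dual lam f x)"
    and "orthonormal_functionals.h \<gamma> (decomp_h_dual lam f x) = decomp_h lam x"
proof -
  let ?e = "decomp_h_dual lam f x"
  have e: "blinfun_apply (?e n) v = blinfun_apply (xd n) v / sqrt (lam n)" for n v
    by (simp add: decomp_h_dual_def blinfun.scaleR_left divide_inverse mult.commute)
  have sq: "sqrt (lam n) * sqrt (lam n) = lam n" for n using pos[of n] by simp
  interpret orthonormal_functionals \<gamma> ?e
  proof unfold_locales
    show "(\<integral>v. blinfun_apply (?e j) v * blinfun_apply (?e k) v \<partial>\<gamma>) = (if j = k then 1 else 0)" for j k
    proof -
      have "(\<integral>v. blinfun_apply (?e j) v * blinfun_apply (?e k) v \<partial>\<gamma>)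
        = (\<integral>v. (blinfun_apply (xd j) v * blinfun_apply (xd k) v) / (sqrt (lam j) * sqrt (lam k)) \<partial>\<gamma>)"
        by (simp add: e)
      also have "\<dots> = (if j = k then lam j else 0) / (sqrt (lam j) * sqrt (lam k))"
        by (simp only: integral_divide_zero xd_orthogonal)
      also have "\<dots> = (if j = k then 1 else 0)" using pos[of k] by simp
      finally show ?thesis .
    qed
  qed
  have h: "h k = decomp_h lam x k" for k
  proof (rule eq_if_functionals_eq)
    fix g :: "'a \<Rightarrow>\<^sub>L real"
    have "blinfun_apply g (h k) = (\<integral>v. (blinfun_apply (xd k) v * blinfun_apply g v) / sqrt (lam k) \<partial>\<gamma>)"
      by (simp add: functional_h e)
    also have "\<dots> = lam k * blinfun_apply g (x k) / sqrt (lam k)"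
      by (simp only: integral_divide_zero integral_xd_functional)
    also have "\<dots> = sqrt (lam k) * blinfun_apply g (x k)"
      using sq[of k] pos[of k] by (simp add: field_simps)
    finally show "blinfun_apply g (h k) = blinfun_apply g (decomp_h lam x k)"
      by (simp add: decomp_h_def blinfun.scaleR_right)
  qed
  then show "h = decomp_h lam x" by (rule ext)
  have tail: "blinfun_apply (tail n) v = blinfun_apply (residual n) v" for n v
  proof -
    have "blinfun_apply (?e k) v *\<^sub>R h k = blinfun_apply (xd k) v *\<^sub>R x k" for k
      using pos[of k] by (simp add: e h decomp_h_def)
    then show ?thesis by (simp add: tail_apply block_apply residual_apply lessThan_atLeast0)
  qed
  show "functional_basis \<gamma> ?e"
  proof unfold_locales
    fix g :: "'a \<Rightarrow>\<^sub>L real"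
    let ?V = "\<integral>v. (blinfun_apply g v)\<^sup>2 \<partial>\<gamma>"
    let ?r = "\<lambda>n. \<integral>v. (blinfun_apply g (blinfun_apply (residual n) v))\<^sup>2 \<partial>\<gamma>"
    have "(\<lambda>n. lam n * (norm g)\<^sup>2) \<longlonglongrightarrow> 0 * (norm g)\<^sup>2"
      by (intro tendsto_intros lam_tendsto_0)
    then have "?r \<longlonglongrightarrow> 0"
      by (intro tendsto_sandwich[of "\<lambda>_. 0" ?r sequentially "\<lambda>n. lam n * (norm g)\<^sup>2"])
        (auto simp: residual_variance_le)
    then have "(\<lambda>n. ?V - ?r n) \<longlonglongrightarrow> ?V - 0" by (intro tendsto_intros)
    moreover have "?V - ?r n = (\<Sum>k<n. (blinfun_apply g (h k))\<^sup>2)" for n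
      using integral_scaled_block_square[of g 1 0 n]
      by (simp add: tail[symmetric] tail_apply lessThan_atLeast0)
    ultimately show "(\<lambda>k. (blinfun_apply g (h k))\<^sup>2) sums ?V" by (simp add: sums_def)
  qed
qed

end

theorem corollary3p8:
  fixes \<gamma> :: "'a::{banach,second_countable_topology} measure"
    and H :: "'a set" and ip :: "'a \<Rightarrow> 'a \<Rightarrow> real"
    and G :: "nat \<Rightarrow> 'a measure" and lam :: "nat \<Rightarrow> real"
    and f :: "nat \<Rightarrow> 'a \<Rightarrow>\<^sub>L real" and x :: "nat \<Rightarrow> 'a"
  assumes "centered_gaussian_measure \<gamma>"
    and "cameron_martin_space \<gamma> H ip"
    and "\<not> (\<exists>B. finite B \<and> span B = H)"
    and "iterative_decomposition \<gamma> G lam f x"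
  shows "(AE v in \<gamma>. (\<lambda>n. blinfun_apply (decomp_h_dual lam f x n) v *\<^sub>R decomp_h lam x n) sums v) \<and>
    prob_space.indep_vars \<gamma> (\<lambda>_. borel) (\<lambda>n. blinfun_apply (decomp_h_dual lam f x n)) UNIV \<and>
    (\<forall>n. distributed \<gamma> lborel (blinfun_apply (decomp_h_dual lam f x n)) (normal_density 0 1)) \<and>
    (\<forall>(M :: 'w measure) \<xi>.
       prob_space M \<longrightarrow>
       prob_space.indep_vars M (\<lambda>_. borel) \<xi> (UNIV :: nat set) \<longrightarrow>
       (\<forall>n. distributed M lborel (\<xi> n) (normal_density 0 1)) \<longrightarrow>
       (AE \<omega> in M. summable (\<lambda>n. (sqrt (lam n) * \<xi> n \<omega>) *\<^sub>R x n)) \<and>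
       (\<lambda>\<omega>. \<Sum>n. (sqrt (lam n) * \<xi> n \<omega>) *\<^sub>R x n) \<in> borel_measurable M \<and>
       distr M borel (\<lambda>\<omega>. \<Sum>n. (sqrt (lam n) * \<xi> n \<omega>) *\<^sub>R x n) = \<gamma>)"
proof -
  interpret centered_gaussian \<gamma>
    using assms(1) by (simp add: centered_gaussian_iff)
  interpret D: gaussian_decomposition \<gamma> G lam f x
    by unfold_locales (rule assms(4))
  have pos: "lam n > 0" for n
    using assms(2,3) by (rule D.lam_pos)
  interpret B: functional_basis \<gamma> "decomp_h_dual lam f x"
    using pos by (rule D.functional_basis_decomp(1))
  have h: "B.h = decomp_h lam x"
    using pos by (rule D.functional_basis_decomp(2))
  have term_eq: "(sqrt (lam n) * c) *\<^sub>R x n = c *\<^sub>R B.h n" for n c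
    by (simp add: h decomp_h_def mult.commute)
  show ?thesis
    unfolding term_eq distributed_std_normal_iff
  proof (intro conjI allI impI)
    show "AE v in \<gamma>. (\<lambda>n. blinfun_apply (decomp_h_dual lam f x n) v *\<^sub>R decomp_h lam x n) sums v"
      using B.AE_sums by (simp add: h)
  next
    fix M :: "'w measure" and \<xi> :: "nat \<Rightarrow> 'w \<Rightarrow> real"
    assume M: "prob_space M" "prob_space.indep_vars M (\<lambda>_. borel) \<xi> UNIV"
      and "\<forall>n. \<xi> n \<in> borel_measurable M \<and> distr M borel (\<xi> n) = std_normal_distribution"
    then have std: "\<And>n. distr M borel (\<xi> n) = std_normal_distribution" by blast
    note law = B.random_series_law[OF M std]
    show "AE \<omega> in M. summable (\<lambda>n. \<xi> n \<omega> *\<^sub>R B.h n)" by (rule law(1))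
    show "(\<lambda>\<omega>. \<Sum>n. \<xi> n \<omega> *\<^sub>R B.h n) \<in> borel_measurable M" by (rule law(2))
    show "distr M borel (\<lambda>\<omega>. \<Sum>n. \<xi> n \<omega> *\<^sub>R B.h n) = \<gamma>" by (rule law(3))
  qed (rule B.indep_vars_e, measurable, rule B.distr_e)
qed

end
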